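(* Let $\mathcal{A}$ be a semiprime, complex, unital Banach algebra with $\mathrm{soc}(\mathcal{A})\neq\{0\}$, let $x\in\mathcal{A}$, and let $\Omega$ be a connected component of $\rho_{BF}(x)$. Then there are exactly the following four possibilities: (1) $x$ has both the left SVEP and the right SVEP at every point of $\Omega$. In this case, $p_l(x-\lambda)=q_l(x-\lambda)<\infty$ for all $\lambda\in\Omega$, and $\sigma(x)$ does not have limit points in $\Omega$. This case occurs exactly when $\Omega$ intersects the resolvent set $\rho(x)$. (2) $x$ has the left SVEP at every point of $\Omega$, whilst $x$ fails to have the right SVEP at each point of $\Omega$. In this case, $p_l(x-\lambda)<\infty$ and $q_l(x-\lambda)=\infty$ for all $\lambda\in\Omega$; $\sigma_l(x)$ does not have limit points in $\Omega$ and $\Omega\subseteq\sigma_r(x)$. (3) $x$ has the right SVEP at every point of $\Omega$, whilst $x$ fails to have the left SVEP at each point of $\Omega$. In this case, $p_l(x-\lambda)=\infty$ and $q_l(x-\lambda)<\infty$ for all $\lambda\in\Omega$; $\sigma_r(x)$ does not have limit points in $\Omega$ and $\Omega\subseteq\sigma_l(x)$. (4) $x$ has neither the left SVEP nor the right SVEP at the points of $\Omega$. In this case, $p_l(x-\lambda)=q_l(x-\lambda)=\infty$ for all $\lambda\in\Omega$, and $\Omega\subseteq\sigma_l(x)\cap\sigma_r(x)$.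
   Context: An algebra is semiprime if $\{0\}$ is its only two-sided ideal $J$ with $J^2=\{0\}$. $\mathrm{soc}(\mathcal{A})$ is the sum of all minimal right ideals of $\mathcal{A}$ (equal to the sum of all minimal left ideals), or $\{0\}$ if there are none. An element $a$ of a ring is Drazin invertible if there are $b$ in the ring and $k\in\mathbb{N}$ with $bab=b$, $ab=ba$, $a^kba=a^k$. An element $a\in\mathcal{A}$ is B-Fredholm if its image in $\mathcal{A}/\mathrm{soc}(\mathcal{A})$ is Drazin invertible. $x-\lambda$ means $x-\lambda1$. $\sigma_{BF}(x)=\{\lambda\in\mathbb{C}:x-\lambda\text{ is not B-Fredholm}\}$ and $\rho_{BF}(x)=\mathbb{C}\setminus\sigma_{BF}(x)$. $x$ has left (resp. right) SVEP at $\lambda\in\mathbb{C}$ if for every connected open neighbourhood $U$ of $\lambda$ the only holomorphic $f:U\to\mathcal{A}$ with $(\mu-x)f(\mu)=0$ (resp. $f(\mu)(\mu-x)=0$) for all $\mu\in U$ is $f\equiv0$. $p_l(x)=\inf\{n\ge0:R(x^n)=R(x^{n+1})\}$ where $R(y)=\{a\in\mathcal{A}:ya=0\}$, and $q_l(x)=\inf\{n\ge0:x^n\mathcal{A}=x^{n+1}\mathcal{A}\}$ (with $\inf\emptyset=\infty$). $\sigma_l(x)$, $\sigma_r(x)$, $\sigma(x)$ are the sets of $\lambda\in\mathbb{C}$ for which $x-\lambda$ is not left invertible, not right invertible, not invertible, respectively; $\rho(x)=\mathbb{C}\setminus\sigma(x)$. *)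

theory Defs
  imports "HOL-Analysis.Analysis" "HOL-Library.Extended_Nat" "HOL-Algebra.QuotRing"
begin

class complex_banach_algebra = real_normed_algebra_1 + banach +
  fixes scaleC :: "complex \<Rightarrow> 'a \<Rightarrow> 'a"  (infixr "*\<^sub>C" 75)
  assumes scaleC_add_right: "c *\<^sub>C (x + y) = c *\<^sub>C x + c *\<^sub>C y"
    and scaleC_add_left: "(c + d) *\<^sub>C x = c *\<^sub>C x + d *\<^sub>C x"
    and scaleC_scaleC: "c *\<^sub>C d *\<^sub>C x = (c * d) *\<^sub>C x"
    and scaleC_of_real: "complex_of_real r *\<^sub>C x = r *\<^sub>R x"
    and mult_scaleC_left: "(c *\<^sub>C x) * y = c *\<^sub>C (x * y)"
    and mult_scaleC_right: "x * (c *\<^sub>C y) = c *\<^sub>C (x * y)"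
    and norm_scaleC: "norm (c *\<^sub>C x) = cmod c * norm x"

lemma scaleC_one: "1 *\<^sub>C x = (x :: 'a::complex_banach_algebra)"
  using scaleC_of_real[of 1 x] by simp

global_interpretation complex_vector: vector_space
  "scaleC :: complex \<Rightarrow> 'a \<Rightarrow> 'a::complex_banach_algebra"
  by unfold_locales (simp_all add: scaleC_add_right scaleC_add_left scaleC_scaleC scaleC_one)

definition of_complex :: "complex \<Rightarrow> 'a::complex_banach_algebra" where
  "of_complex c = c *\<^sub>C 1"


subsection \<open>Ideals, semiprimeness and the socle\<close>

text \<open>The algebra is the whole type \<open>'a\<close>; properties of the algebra take a type argument.\<close>

definition right_ideal :: "'a::complex_banach_algebra set \<Rightarrow> bool" where
  "right_ideal J \<longleftrightarrow> complex_vector.subspace J \<and> (\<forall>j\<in>J. \<forall>a. j * a \<in> J)"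

definition left_ideal :: "'a::complex_banach_algebra set \<Rightarrow> bool" where
  "left_ideal J \<longleftrightarrow> complex_vector.subspace J \<and> (\<forall>j\<in>J. \<forall>a. a * j \<in> J)"

definition two_sided_ideal :: "'a::complex_banach_algebra set \<Rightarrow> bool" where
  "two_sided_ideal J \<longleftrightarrow> left_ideal J \<and> right_ideal J"

definition ideal_product ::
    "'a::complex_banach_algebra set \<Rightarrow> 'a set \<Rightarrow> 'a set" where
  "ideal_product I J = complex_vector.span {a * b |a b. a \<in> I \<and> b \<in> J}"

definition semiprime_algebra :: "'a::complex_banach_algebra itself \<Rightarrow> bool" where
  "semiprime_algebra _ \<longleftrightarrow>
     (\<forall>J :: 'a set. two_sided_ideal J \<and> ideal_product J J = {0} \<longrightarrow> J = {0})"

definition minimal_right_ideal :: "'a::complex_banach_algebra set \<Rightarrow> bool" where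
  "minimal_right_ideal J \<longleftrightarrow> right_ideal J \<and> J \<noteq> {0} \<and>
     (\<forall>K. right_ideal K \<and> K \<subseteq> J \<longrightarrow> K = {0} \<or> K = J)"

text \<open>A sum of a family of right ideals is the linear span of their union; if there are no
  minimal right ideals this is the span of the empty set, that is \<open>{0}\<close>.\<close>

definition soc :: "'a::complex_banach_algebra set" where
  "soc = complex_vector.span (\<Union> {J. minimal_right_ideal J})"


subsection \<open>Drazin invertibility and B-Fredholm elements\<close>

definition drazin_invertible :: "('r, 'm) ring_scheme \<Rightarrow> 'r \<Rightarrow> bool" where
  "drazin_invertible R a \<longleftrightarrow> a \<in> carrier R \<and>
     (\<exists>b\<in>carrier R. \<exists>k::nat.
        b \<otimes>\<^bsub>R\<^esub> a \<otimes>\<^bsub>R\<^esub> b = b \<and> a \<otimes>\<^bsub>R\<^esub> b = b \<otimes>\<^bsub>R\<^esub> a \<and>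
        a [^]\<^bsub>R\<^esub> k \<otimes>\<^bsub>R\<^esub> b \<otimes>\<^bsub>R\<^esub> a = a [^]\<^bsub>R\<^esub> k)"

text \<open>The ring structure of the type, in the record form needed for the quotient \<open>Quot\<close>.\<close>

definition type_ring :: "'a::ring_1 ring" where
  "type_ring = \<lparr>carrier = UNIV, mult = (*), one = 1, zero = 0, add = (+)\<rparr>"

lemma ring_type_ring: "ring (type_ring :: 'a::ring_1 ring)"
  by (unfold_locales)
     (auto simp: type_ring_def Units_def algebra_simps intro: exI[where x = "- _"])

definition B_Fredholm :: "'a::complex_banach_algebra \<Rightarrow> bool" where
  "B_Fredholm a \<longleftrightarrow>
     drazin_invertible (type_ring Quot (soc :: 'a set)) (soc +>\<^bsub>type_ring\<^esub> a)"

definition BF_spectrum :: "'a::complex_banach_algebra \<Rightarrow> complex set" where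
  "BF_spectrum x = {\<zeta>. \<not> B_Fredholm (x - of_complex \<zeta>)}"

definition BF_resolvent :: "'a::complex_banach_algebra \<Rightarrow> complex set" where
  "BF_resolvent x = - BF_spectrum x"


subsection \<open>Spectra\<close>

definition left_spectrum :: "'a::complex_banach_algebra \<Rightarrow> complex set" where
  "left_spectrum x = {\<zeta>. \<not> (\<exists>y. y * (x - of_complex \<zeta>) = 1)}"

definition right_spectrum :: "'a::complex_banach_algebra \<Rightarrow> complex set" where
  "right_spectrum x = {\<zeta>. \<not> (\<exists>y. (x - of_complex \<zeta>) * y = 1)}"

definition spectrum :: "'a::complex_banach_algebra \<Rightarrow> complex set" where
  "spectrum x =
     {\<zeta>. \<not> (\<exists>y. y * (x - of_complex \<zeta>) = 1 \<and> (x - of_complex \<zeta>) * y = 1)}"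

definition resolvent_set :: "'a::complex_banach_algebra \<Rightarrow> complex set" where
  "resolvent_set x = - spectrum x"


subsection \<open>The single-valued extension property\<close>

text \<open>The library's \<open>holomorphic_on\<close> covers complex-valued functions only. Complex
  differentiability means that the real Frechet derivative is of the form
  \<open>h \<mapsto> h *\<^sub>C d\<close>.\<close>

definition vector_holomorphic_on ::
    "(complex \<Rightarrow> 'a::complex_banach_algebra) \<Rightarrow> complex set \<Rightarrow> bool" where
  "vector_holomorphic_on f U \<longleftrightarrow>
     (\<forall>z\<in>U. \<exists>d. (f has_derivative (\<lambda>h. h *\<^sub>C d)) (at z within U))"

definition left_SVEP_at :: "'a::complex_banach_algebra \<Rightarrow> complex \<Rightarrow> bool" where
  "left_SVEP_at x \<zeta> \<longleftrightarrow>
     (\<forall>U f. open U \<and> connected U \<and> \<zeta> \<in> U \<and> vector_holomorphic_on f U \<and>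
        (\<forall>\<mu>\<in>U. (of_complex \<mu> - x) * f \<mu> = 0) \<longrightarrow> (\<forall>\<mu>\<in>U. f \<mu> = 0))"

definition right_SVEP_at :: "'a::complex_banach_algebra \<Rightarrow> complex \<Rightarrow> bool" where
  "right_SVEP_at x \<zeta> \<longleftrightarrow>
     (\<forall>U f. open U \<and> connected U \<and> \<zeta> \<in> U \<and> vector_holomorphic_on f U \<and>
        (\<forall>\<mu>\<in>U. f \<mu> * (of_complex \<mu> - x) = 0) \<longrightarrow> (\<forall>\<mu>\<in>U. f \<mu> = 0))"


subsection \<open>Left ascent and left descent\<close>

definition right_annihilator :: "'a::complex_banach_algebra \<Rightarrow> 'a set" where
  "right_annihilator y = {a. y * a = 0}"

text \<open>In \<open>enat\<close>, the infimum of the empty set is \<open>\<infinity>\<close>.\<close>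

definition p_l :: "'a::complex_banach_algebra \<Rightarrow> enat" where
  "p_l x = Inf (enat ` {n. right_annihilator (x ^ n) = right_annihilator (x ^ (n + 1))})"

definition q_l :: "'a::complex_banach_algebra \<Rightarrow> enat" where
  "q_l x = Inf (enat ` {n. range (\<lambda>a. x ^ n * a) = range (\<lambda>a. x ^ (n + 1) * a)})"

end

theory Submission
  imports Defs "HOL-Complex_Analysis.Conformal_Mappings"
begin

text \<open>
  Put \<open>a = x - \<lambda>\<close> for \<open>\<lambda> \<in> \<Omega>\<close>. The socle is von Neumann regular and its elements lie in right ideals of
  finite length. Hence the powers \<open>a\<^sup>n\<close> are regular for large \<open>n\<close> and the chain
  \<open>R(a) \<inter> a\<^sup>n A\<close> becomes stationary, say from \<open>d\<close> on. If its limit is \<open>0\<close>, then \<open>p\<^sub>l(a)\<close> is finite,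
  \<open>a\<close> is left invertible on the corner given by \<open>a\<^sup>d A\<close> and nilpotent modulo it, so \<open>a - \<mu>\<close> is left
  invertible for small \<open>\<mu> \<noteq> 0\<close>. Otherwise \<open>p\<^sub>l(a) = \<infinity>\<close> and a nonzero \<open>u\<close> in the limit is the start of
  a chain \<open>a g\<^sup>n\<^sup>+\<^sup>1 u = g\<^sup>n u\<close>, so that \<open>\<mu> \<mapsto> (1 - \<mu> g)\<^sup>-\<^sup>1 u\<close> violates the left SVEP on a whole disc. Thus
  the left SVEP is a locally constant property on \<open>\<Omega>\<close>, equivalent to \<open>p\<^sub>l < \<infinity>\<close>; the opposite algebra
  gives the same for the right SVEP and \<open>q\<^sub>l\<close>.
\<close>

section \<open>The identity theorem for vector-valued functions\<close>

text \<open>In a Banach algebra, injectivity of \<open>a\<close> on a right ideal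
  \<open>a ^ n * A\<close> yields no left inverse by itself; von Neumann regularity of the powers
  supplies it. The B-Fredholm property controls \<open>a\<close> only modulo the socle, so
  regularity of socle elements has to be lifted to the powers of \<open>a\<close>, which McCoy's
  lemma does. \<open>uniform_descent\<close> records the two facts extracted from the B-Fredholm
  property, in purely ring-theoretic terms. The socle is built from right ideals, so the passage to
  the opposite algebra rests on the left-right symmetry of uniform descent itself. The SVEP asks for
  vanishing on all of an arbitrary connected neighbourhood, whereas one-sided inverses are available
  only on a small punctured disc. An identity theorem for algebra-valued functions bridges the gap;
  it is reduced to the scalar one by functionals from a Hahn-Banach theorem.\<close>

definition sublinear :: "('a::real_vector \<Rightarrow> real) \<Rightarrow> bool" where
  "sublinear p \<longleftrightarrow> (\<forall>x y. p (x + y) \<le> p x + p y) \<and> (\<forall>r\<ge>0. \<forall>x. p (r *\<^sub>R x) = r * p x)"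

lemma sublinear_zero: "sublinear p \<Longrightarrow> p 0 = 0"
  unfolding sublinear_def by (metis mult_zero_left order_refl scaleR_zero_left)

lemma sublinear_lower: "sublinear p \<Longrightarrow> - p (- x) \<le> p x"
  using sublinear_zero[of p] unfolding sublinear_def by (metis add.commute add.right_inverse diff_0 le_diff_eq minus_add_cancel diff_le_eq)

text \<open>\<open>q\<close> is the largest sublinear functional below \<open>p\<close> with
  \<open>q (- v) \<le> - p v\<close>, that is, \<open>p\<close> made linear along \<open>v\<close>.
  The two upper bounds are the values at \<open>t = 1\<close> and \<open>t = 0\<close>.\<close>

lemma sublinear_INF:
  fixes v x :: "'a::real_vector"
  assumes "sublinear p"
  defines "q \<equiv> \<lambda>x. INF t\<in>{0..}. p (x + t *\<^sub>R v) - t * p v"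
  shows "sublinear q" and "q x \<le> p (x + v) - p v" and "q x \<le> p x"
proof -
  have add: "p (x + y) \<le> p x + p y" and scale: "r \<ge> 0 \<Longrightarrow> p (r *\<^sub>R x) = r * p x" for x y r
    using assms(1) by (auto simp: sublinear_def)
  have bound: "- p (- x) \<le> p (x + t *\<^sub>R v) - t * p v" if "t \<ge> 0" for x t
    using add[of "x + t *\<^sub>R v" "- x"] scale[OF that, of v] by simp
  then have bdd: "bdd_below ((\<lambda>t. p (x + t *\<^sub>R v) - t * p v) ` {0..})" for x
    by (intro bdd_belowI2[of _ "- p (- x)"]) auto
  have lower: "q x \<le> p (x + t *\<^sub>R v) - t * p v" if "t \<ge> 0" for x t
    unfolding q_def using that by (intro cINF_lower bdd) auto
  have greatest: "m \<le> q x" if "\<And>t. t \<ge> 0 \<Longrightarrow> m \<le> p (x + t *\<^sub>R v) - t * p v" for m x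
    unfolding q_def using that by (intro cINF_greatest) auto
  show "q x \<le> p (x + v) - p v" "q x \<le> p x"
    using lower[of 1 x] lower[of 0 x] by auto
  have q_add: "q (x + y) \<le> q x + q y" for x y
  proof -
    have "q (x + y) - (p (y + s *\<^sub>R v) - s * p v) \<le> q x" if s: "s \<ge> 0" for s
    proof (rule greatest)
      fix t :: real assume t: "t \<ge> 0"
      show "q (x + y) - (p (y + s *\<^sub>R v) - s * p v) \<le> p (x + t *\<^sub>R v) - t * p v"
        using lower[of "t + s" "x + y"] add[of "x + t *\<^sub>R v" "y + s *\<^sub>R v"] s t
        by (simp add: algebra_simps)
    qed
    then have "q (x + y) - q x \<le> q y"
      by (intro greatest) (simp add: algebra_simps)
    then show ?thesis by simp
  qed
  \<comment> \<open>One inequality suffices: applied to \<open>1 / r\<close> and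
    \<open>r *\<^sub>R x\<close> it gives the reverse one.\<close>
  have q_le: "r * q x \<le> q (r *\<^sub>R x)" if r: "r > 0" for r x
  proof (rule greatest)
    fix t :: real assume t: "t \<ge> 0"
    have "r * q x \<le> r * (p (x + (t / r) *\<^sub>R v) - t / r * p v)"
      using lower[of "t / r" x] r t by (intro mult_left_mono) auto
    also have "\<dots> = p (r *\<^sub>R x + t *\<^sub>R v) - t * p v"
      using r scale[of r "x + (t / r) *\<^sub>R v"] by (simp add: algebra_simps)
    finally show "r * q x \<le> p (r *\<^sub>R x + t *\<^sub>R v) - t * p v" .
  qed
  have "q (r *\<^sub>R x) = r * q x" if r: "r > 0" for r x
    using q_le[OF r, of x] q_le[of "1 / r" "r *\<^sub>R x"] r by (simp add: field_simps)
  moreover have "q 0 = 0"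
  proof (rule antisym)
    show "q 0 \<le> 0" using lower[of 0 0] sublinear_zero[OF assms(1)] by simp
    show "0 \<le> q 0" by (rule greatest) (simp add: scale)
  qed
  ultimately have "q (r *\<^sub>R x) = r * q x" if "r \<ge> 0" for r x
    using that by (cases "r = 0") auto
  with q_add show "sublinear q"
    by (simp add: sublinear_def)
qed

text \<open>The Hahn-Banach theorem, with the dominated functional found as a minimal sublinear one:
  for minimal \<open>p\<close> the functional of sublinear_INF is \<open>p\<close> itself, which forces additivity.\<close>

lemma linear_below_sublinear:
  fixes p :: "'a::real_vector \<Rightarrow> real"
  assumes "sublinear p"
  shows "\<exists>f. linear f \<and> (\<forall>x. f x \<le> p x)"
proof -
  define S where "S = {q. sublinear q \<and> q \<le> p}"
  have "\<exists>m\<in>S. \<forall>q\<in>S. q \<le> m \<longrightarrow> q = m"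
  proof (rule predicate_Zorn)
    \<comment> \<open>The order is reversed, so that the maximal element of Zorn's lemma is a
      minimal functional.\<close>
    show "partial_order_on S (relation_of (\<lambda>q r. r \<le> q) S)"
      by (rule partial_order_on_relation_ofI) auto
    fix C assume C: "C \<in> Chains (relation_of (\<lambda>q r. r \<le> q) S)"
    then have CS: "C \<subseteq> S" and chain: "\<And>q r. q \<in> C \<Longrightarrow> r \<in> C \<Longrightarrow> r \<le> q \<or> q \<le> r"
      by (auto simp: Chains_def relation_of_def)
    show "\<exists>u\<in>S. \<forall>q\<in>C. u \<le> q"
    proof (cases "C = {}")
      case True
      then show ?thesis using assms by (auto simp: S_def)
    next
      case False
      define u where "u x = (INF q\<in>C. q x)" for x
      have sub: "sublinear q" "q x \<le> p x" if "q \<in> C" for q x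
        using that CS by (auto simp: S_def le_fun_def)
      have "- p (- x) \<le> q x" if "q \<in> C" for q x
        using sublinear_lower[OF sub(1)[OF that], of x] sub(2)[OF that, of "- x"] by simp
      then have bdd: "bdd_below ((\<lambda>q. q x) ` C)" for x
        by (intro bdd_belowI2[of _ "- p (- x)"])
      have lower: "u x \<le> q x" if "q \<in> C" for q x
        unfolding u_def using that by (intro cINF_lower bdd)
      have greatest: "m \<le> u x" if "\<And>q. q \<in> C \<Longrightarrow> m \<le> q x" for m x
        unfolding u_def using that False by (intro cINF_greatest)
      have "u (x + y) \<le> u x + u y" for x y
      proof -
        \<comment> \<open>The chain condition is needed here: the smaller of \<open>q\<close> and
          \<open>r\<close> is a single member that bounds both summands.\<close>
        have "u (x + y) \<le> q x + r y" if "q \<in> C" "r \<in> C" for q r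
        proof -
          obtain s where s: "s \<in> C" "s \<le> q" "s \<le> r"
            using chain[OF \<open>q \<in> C\<close> \<open>r \<in> C\<close>] \<open>q \<in> C\<close> \<open>r \<in> C\<close> by (metis order_refl)
          have "u (x + y) \<le> s x + s y"
            using lower[OF s(1)] sub(1)[OF s(1)] unfolding sublinear_def by (blast intro: order_trans)
          also have "\<dots> \<le> q x + r y" using s by (intro add_mono) (auto simp: le_fun_def)
          finally show ?thesis .
        qed
        then have "u (x + y) - r y \<le> u x" if "r \<in> C" for r
          using that by (intro greatest) (simp add: algebra_simps)
        then have "u (x + y) - u x \<le> u y"
          by (intro greatest) (simp add: algebra_simps)
        then show ?thesis by simp
      qed
      moreover have "u (r *\<^sub>R x) = r * u x" if r: "r \<ge> 0" for r x
      proof (cases "r = 0")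
        case True
        then show ?thesis using sub(1) False by (simp add: u_def sublinear_zero)
      next
        case False
        with r have r: "r > 0" by simp
        have scale: "q (r *\<^sub>R x) = r * q x" if "q \<in> C" for q
          using sub(1)[OF that] r by (auto simp: sublinear_def)
        have "r * u x \<le> u (r *\<^sub>R x)"
          using lower r by (intro greatest) (simp add: scale)
        moreover have "u (r *\<^sub>R x) / r \<le> u x"
          using lower[of _ "r *\<^sub>R x"] r by (intro greatest) (simp add: scale field_simps)
        ultimately show ?thesis using r by (simp add: field_simps)
      qed
      moreover have "u \<le> p"
        unfolding le_fun_def using False lower sub(2) by (meson all_not_in_conv order_trans)
      ultimately have "u \<in> S" by (simp add: S_def sublinear_def)
      with lower show ?thesis unfolding le_fun_def by blast
    qed
  qed
  then obtain f where "f \<in> S" and f_min: "\<forall>q\<in>S. q \<le> f \<longrightarrow> q = f"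
    by blast
  then have f: "sublinear f" "f \<le> p"
    by (simp_all add: S_def)
  have minimal: "q = f" if "sublinear q" "q \<le> f" for q
    using that f_min order_trans[OF that(2) f(2)] by (simp add: S_def)
  have "f x \<le> f (x + v) - f v" for x v
  proof -
    note q = sublinear_INF[OF f(1), where v = v]
    have "(\<lambda>x. INF t\<in>{0..}. f (x + t *\<^sub>R v) - t * f v) = f"
      by (rule minimal[OF q(1)]) (rule le_funI, rule q(3))
    from fun_cong[OF this, of x] q(2)[of x] show ?thesis by (rule subst)
  qed
  moreover have "f (x + v) \<le> f x + f v" for x v
    using f(1) by (simp add: sublinear_def)
  ultimately have add: "f (x + v) = f x + f v" for x v
    by (metis le_diff_eq order_antisym)
  have neg: "f (- x) = - f x" for x
    using add[of x "- x"] sublinear_zero[OF f(1)] by simp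
  have "f (r *\<^sub>R x) = r * f x" for r x
  proof (cases "r \<ge> 0")
    case True
    then show ?thesis using f(1) by (auto simp: sublinear_def)
  next
    case False
    then have "f ((- r) *\<^sub>R x) = - r * f x"
      using f(1)[unfolded sublinear_def] by (meson le_minus_iff minus_zero linear order_refl neg_0_le_iff_le)
    then show ?thesis using neg[of "r *\<^sub>R x"] by simp
  qed
  with add f(2) show ?thesis by (auto intro!: exI[of _ f] linearI simp: le_fun_def)
qed

text \<open>Starting from the norm made linear along \<open>v\<close>, instead of the norm itself,
  forces \<open>f (- v) \<le> - norm v\<close> and hence \<open>f v \<noteq> 0\<close>, without
  extending a functional from a subspace.\<close>

lemma bounded_linear_functional_nonzero:
  fixes v :: "'a::real_normed_vector"
  assumes "v \<noteq> 0"
  obtains f :: "'a \<Rightarrow> real" where "bounded_linear f" "f v \<noteq> 0"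
proof -
  have "sublinear (norm :: 'a \<Rightarrow> real)" by (auto simp: sublinear_def norm_triangle_ineq)
  note q = sublinear_INF[OF this, where v = v]
  obtain f where f: "linear f" "\<And>x. f x \<le> (INF t\<in>{0..}. norm (x + t *\<^sub>R v) - t * norm v)"
    using linear_below_sublinear[OF q(1)] by auto
  have le: "f x \<le> norm x" for x using f(2) q(3) order_trans by blast
  have "f (- v) \<le> - norm v" using f(2)[of "- v"] q(2)[of "- v"] by simp
  then have "f v \<noteq> 0" using assms linear_neg[OF f(1)] by auto
  moreover have "\<bar>f x\<bar> \<le> norm x" for x
    using le[of x] le[of "- x"] linear_neg[OF f(1), of x] by simp
  then have "bounded_linear f"
    using f(1) by (intro bounded_linear_intro[of f 1]) (simp_all add: linear_add linear_scale)
  ultimately show thesis using that by blast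
qed

lemma complex_functional_nonzero:
  fixes v :: "'a::complex_banach_algebra"
  assumes "v \<noteq> 0"
  shows "\<exists>f :: 'a \<Rightarrow> complex. bounded_linear f \<and> (\<forall>c x. f (c *\<^sub>C x) = c * f x) \<and> f v \<noteq> 0"
proof -
  obtain g :: "'a \<Rightarrow> real" where g: "bounded_linear g" "g v \<noteq> 0"
    using bounded_linear_functional_nonzero[OF assms] .
  interpret g: bounded_linear g by (fact g(1))
  \<comment> \<open>The usual complexification \<open>g x - \<i> * g (\<i> x)\<close> of a real
    functional, which is complex linear with real part \<open>g\<close>.\<close>
  define f where "f x = Complex (g x) (- g (\<i> *\<^sub>C x))" for x
  have split: "c *\<^sub>C x = Re c *\<^sub>R x + Im c *\<^sub>R (\<i> *\<^sub>C x)" for c and x :: 'a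
    by (simp flip: scaleC_of_real add: scaleC_scaleC flip: scaleC_add_left)
       (metis complex_eq mult.commute)
  have ii: "\<i> *\<^sub>C (c *\<^sub>C x) = Re c *\<^sub>R (\<i> *\<^sub>C x) - Im c *\<^sub>R x" for c and x :: 'a
    using split[of "\<i> * c" x] by (simp add: scaleC_scaleC)
  have fC: "f (c *\<^sub>C x) = c * f x" for c x
    unfolding f_def ii unfolding split[of c x]
    by (simp add: g.add g.diff g.scale complex_eq_iff)
  have bl: "bounded_linear (\<lambda>x::'a. \<i> *\<^sub>C x)"
    by (rule bounded_linear_intro[of _ 1])
       (simp_all add: scaleC_add_right norm_scaleC scaleC_scaleC mult.commute flip: scaleC_of_real)
  have "bounded_linear (\<lambda>x. of_real (g x) - \<i> * of_real (g (\<i> *\<^sub>C x)))"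
    by (intro bounded_linear_sub bounded_linear_const_mult bounded_linear_compose[OF bounded_linear_of_real]
        bounded_linear_compose[OF g(1)] bl bounded_linear_ident g(1))
  also have "(\<lambda>x. of_real (g x) - \<i> * of_real (g (\<i> *\<^sub>C x))) = f"
    by (auto simp: f_def complex_eq_iff)
  finally have "bounded_linear f" .
  moreover have "f v \<noteq> 0" using g(2) by (simp add: f_def complex_eq_iff)
  ultimately show ?thesis using fC by blast
qed

text \<open>A complex linear functional \<open>\<phi>\<close> maps the derivative
  \<open>h *\<^sub>C d\<close> to \<open>h * \<phi> d\<close>, so \<open>\<phi> \<circ> f\<close> is
  holomorphic in the scalar sense. If \<open>f z\<close> were nonzero, a \<open>\<phi>\<close> not
  vanishing there would contradict the scalar identity theorem.\<close>

lemma vector_holomorphic_identity: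
  assumes "vector_holomorphic_on f U" "open U" "connected U" "V \<subseteq> U" "\<xi> \<in> U" "\<xi> islimpt V"
    and "\<And>z. z \<in> V \<Longrightarrow> f z = 0" and "z \<in> U"
  shows "f z = 0"
proof (rule ccontr)
  assume "f z \<noteq> 0"
  then obtain \<phi> where \<phi>: "bounded_linear \<phi>" "\<And>c x. \<phi> (c *\<^sub>C x) = c * \<phi> x" "\<phi> (f z) \<noteq> 0"
    using complex_functional_nonzero by blast
  have "(\<lambda>w. \<phi> (f w)) holomorphic_on U"
    unfolding holomorphic_on_def field_differentiable_def has_field_derivative_def
  proof
    fix w assume "w \<in> U"
    then obtain d where "(f has_derivative (\<lambda>h. h *\<^sub>C d)) (at w within U)"
      using assms(1) by (auto simp: vector_holomorphic_on_def)
    from bounded_linear.has_derivative[OF \<phi>(1) this]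
    show "\<exists>d. ((\<lambda>w. \<phi> (f w)) has_derivative (*) d) (at w within U)"
      by (intro exI[of _ "\<phi> d"]) (simp add: \<phi>(2) mult.commute[of _ "\<phi> d"])
  qed
  moreover have "\<phi> (f w) = 0" if "w \<in> V" for w
    using assms(7)[OF that] linear_0[OF bounded_linear.linear[OF \<phi>(1)]] by simp
  ultimately have "\<phi> (f z) = 0"
    using analytic_continuation[of "\<lambda>w. \<phi> (f w)", OF _ assms(2-6) _ assms(8)] by blast
  with \<phi>(3) show False by simp
qed

section \<open>Scalars and the Neumann series\<close>

lemma of_complex_mult_left: "of_complex c * y = c *\<^sub>C y"
  by (simp add: of_complex_def mult_scaleC_left)

lemma of_complex_mult_right: "y * of_complex c = c *\<^sub>C y"
  by (simp add: of_complex_def mult_scaleC_right)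

lemma of_complex_diff: "of_complex (c - d) = of_complex c - of_complex d"
  by (simp add: of_complex_def complex_vector.scale_left_diff_distrib)

lemma of_complex_power: "of_complex c ^ n = of_complex (c ^ n)"
  by (induction n) (simp_all add: of_complex_def mult_scaleC_left scaleC_scaleC scaleC_one)

text \<open>The last clause passes a relation valid for every term of the series to its sum. It will
  carry \<open>a * g ^ Suc n * u = g ^ n * u\<close> over to the resolvent of \<open>g\<close>; the
  norm bound will control its difference quotients.\<close>

lemma neumann_series:
  fixes y :: "'a::{real_normed_algebra_1, banach}"
  assumes "norm y < 1"
  shows "\<exists>w. w * (1 - y) = 1 \<and> (1 - y) * w = 1 \<and> norm w \<le> 1 / (1 - norm y) \<and>
    (\<forall>c u. (\<forall>n. c * y ^ n * u = 0) \<longrightarrow> c * w * u = 0)"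
proof -
  have summable: "summable (\<lambda>n. y ^ n)"
    using assms by (rule complete_algebra_summable_geometric)
  define w where "w = (\<Sum>n. y ^ n)"
  have split: "w = 1 + (\<Sum>n. y ^ Suc n)"
    unfolding w_def using suminf_split_head[OF summable] by simp
  have "(\<Sum>n. y ^ Suc n) = y * w"
    unfolding w_def using suminf_mult[OF summable, of y] by simp
  then have "(1 - y) * w = 1" using split by (simp add: algebra_simps)
  have "(\<Sum>n. y ^ Suc n) = w * y"
    unfolding w_def using suminf_mult2[OF summable, of y] by (simp add: power_commutes)
  then have "w * (1 - y) = 1" using split by (simp add: algebra_simps)
  have norms: "summable (\<lambda>n. norm (y ^ n))"
    by (rule summable_comparison_test[OF _ summable_geometric[of "norm y"]])
      (use assms in \<open>auto simp: norm_power_ineq\<close>)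
  have "norm w \<le> (\<Sum>n. norm (y ^ n))"
    unfolding w_def by (rule summable_norm[OF norms])
  also have "\<dots> \<le> (\<Sum>n. norm y ^ n)"
    by (intro suminf_le norms norm_power_ineq) (use assms in simp)
  also have "\<dots> = 1 / (1 - norm y)" using assms by (intro suminf_geometric) simp
  finally have "norm w \<le> 1 / (1 - norm y)" .
  moreover have "c * w * u = 0" if "\<And>n. c * y ^ n * u = 0" for c u
    using suminf_mult2[OF summable_mult[OF summable, of c], of u] suminf_mult[OF summable, of c] that
    by (simp add: w_def)
  ultimately show ?thesis
    using \<open>(1 - y) * w = 1\<close> \<open>w * (1 - y) = 1\<close> by blast
qed

section \<open>Von Neumann regular elements and uniform descent\<close>

definition vn_regular :: "'a::ring_1 \<Rightarrow> bool" where
  "vn_regular a \<longleftrightarrow> (\<exists>c. a * c * a = a)"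

text \<open>McCoy's lemma.\<close>

lemma vn_regular_if_diff:
  fixes a :: "'a::ring_1"
  assumes "vn_regular (a - a * c * a)"
  shows "vn_regular a"
proof -
  obtain t where "(a - a * c * a) * t * (a - a * c * a) = a - a * c * a"
    using assms by (auto simp: vn_regular_def)
  \<comment> \<open>The witness comes from writing \<open>a - a * c * a\<close> as
    \<open>a * (1 - c * a)\<close> on the left of \<open>t\<close> and as
    \<open>(1 - a * c) * a\<close> on the right.\<close>
  then have "a * (c + (1 - c * a) * t * (1 - a * c)) * a = a"
    by (simp add: algebra_simps)
  then show ?thesis by (auto simp: vn_regular_def)
qed

lemma power_annihilator_mono:
  fixes a :: "'a::ring_1"
  assumes "\<And>z. a ^ Suc n * z = 0 \<Longrightarrow> a ^ n * z = 0" and "n \<le> m" and "a ^ Suc m * z = 0"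
  shows "a ^ m * z = 0"
proof -
  have "a ^ Suc n * (a ^ (m - n) * z) = 0"
    using assms(2,3) by (simp add: mult.assoc[symmetric] flip: power_add power_Suc)
  then have "a ^ n * (a ^ (m - n) * z) = 0" by (rule assms(1))
  then show ?thesis using assms(2) by (simp add: mult.assoc[symmetric] flip: power_add)
qed

lemma power_annihilator_add:
  fixes a :: "'a::ring_1"
  assumes "\<And>z. a ^ Suc n * z = 0 \<Longrightarrow> a ^ n * z = 0" and "a ^ (n + k) * z = 0"
  shows "a ^ n * z = 0"
  using assms(2)
proof (induction k)
  case (Suc k)
  then show ?case using power_annihilator_mono[OF assms(1), of "n + k" z] by simp
qed simp

text \<open>The elements \<open>a ^ d * z\<close> with \<open>a ^ Suc d * z = 0\<close> form R(a)
  \<inter> \<open>a ^ d * A\<close>, so the second clause says that R(a) \<inter>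
  \<open>a ^ n * A\<close> is constant from \<open>d\<close> on. Regularity of the powers plays the
  part of complemented kernels and ranges in operator theory.\<close>

definition uniform_descent :: "'a::ring_1 \<Rightarrow> nat \<Rightarrow> bool" where
  "uniform_descent a d \<longleftrightarrow> (\<forall>n\<ge>d. vn_regular (a ^ n)) \<and>
     (\<forall>m\<ge>d. \<forall>z. a ^ Suc d * z = 0 \<longrightarrow> (\<exists>w. a ^ d * z = a ^ m * w))"

text \<open>Uniform descent is left-right symmetric: taking left annihilators in
  \<open>a A + R(a\<^sup>m) = a A + R(a\<^sup>m\<^sup>+\<^sup>1)\<close> turns the right-hand chain into the left-hand one.\<close>

lemma uniform_descent_left:
  fixes a :: "'a::ring_1"
  assumes "uniform_descent a d" and "d \<le> m" and "z * a ^ Suc d = 0"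
  shows "\<exists>w. z * a ^ d = w * a ^ m"
  using assms(2)
proof (induction m rule: dec_induct)
  case (step k)
  then obtain w where w: "z * a ^ d = w * a ^ k" by blast
  obtain c where c: "a ^ Suc k * c * a ^ Suc k = a ^ Suc k"
    using assms(1) step.hyps unfolding uniform_descent_def vn_regular_def by (meson le_SucI)
  \<comment> \<open>By uniform descent \<open>a ^ k * q\<close>, which lies in R(a), has the form
    \<open>a ^ Suc k * v\<close>; then \<open>w * a ^ k * q = z * a ^ Suc d * v = 0\<close>. Thus
    \<open>w * a ^ k\<close> kills the right annihilator of the regular element
    \<open>a ^ Suc k\<close> and is a left multiple of it.\<close>
  have "w * a ^ k * q = 0" if q: "a ^ Suc k * q = 0" for q
  proof -
    have split: "a ^ k = a ^ d * a ^ (k - d)" using step.hyps by (simp flip: power_add)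
    have "a ^ Suc d * (a ^ (k - d) * q) = 0"
      using q unfolding power_Suc split by (simp add: mult.assoc)
    then obtain v where "a ^ d * (a ^ (k - d) * q) = a ^ Suc k * v"
      using assms(1) step.hyps unfolding uniform_descent_def by (meson le_SucI)
    then have "a ^ k * q = a ^ k * (a * v)"
      unfolding power_Suc2 by (simp add: mult.assoc[symmetric] flip: split)
    then have "w * a ^ k * q = w * a ^ k * a * v" by (simp add: mult.assoc)
    also have "w * a ^ k * a = z * a ^ Suc d" by (simp add: power_commutes mult.assoc flip: w)
    finally show ?thesis using assms(3) by simp
  qed
  moreover have "a ^ Suc k * (1 - c * a ^ Suc k) = 0"
    using c by (simp add: right_diff_distrib mult.assoc)
  ultimately have "w * a ^ k * (1 - c * a ^ Suc k) = 0" by blast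
  then have "w * a ^ k = w * a ^ k * c * a ^ Suc k"
    by (metis eq_iff_diff_eq_0 mult.assoc mult_1_right right_diff_distrib)
  then show ?case using w by metis
qed auto

text \<open>For a generalised inverse \<open>w\<close> of \<open>a ^ d\<close>, the idempotent
  \<open>e = a ^ d * w\<close> generates the right ideal \<open>a ^ d * A\<close>. There
  \<open>a\<close> is injective by \<open>inj\<close>, and a generalised inverse of
  \<open>a ^ Suc d\<close> turns this into a left inverse \<open>h\<close> of \<open>a\<close> on
  the range of \<open>e\<close>.\<close>

lemma injective_on_range_left_inverse:
  fixes a :: "'a::ring_1"
  assumes "vn_regular (a ^ d)" "vn_regular (a ^ Suc d)"
    and inj: "\<And>z. a ^ Suc d * z = 0 \<Longrightarrow> a ^ d * z = 0"
  shows "\<exists>e h. e * a ^ d = a ^ d \<and> h * a * e = e \<and> h * e = h"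
proof -
  obtain w where w: "a ^ d * w * a ^ d = a ^ d" using assms(1) by (auto simp: vn_regular_def)
  obtain c where c: "a ^ Suc d * c * a ^ Suc d = a ^ Suc d"
    using assms(2) unfolding vn_regular_def by blast
  have "a ^ Suc d * (1 - c * a ^ Suc d) = 0"
    using c by (simp add: right_diff_distrib mult.assoc)
  from inj[OF this] have c': "a ^ d * c * a ^ Suc d = a ^ d"
    by (metis eq_iff_diff_eq_0 mult.assoc mult_1_right right_diff_distrib)
  define e where "e = a ^ d * w"
  have e: "e * a ^ d = a ^ d" using w by (simp add: e_def)
  then have "e * e = e" by (metis e_def mult.assoc)
  have ae: "a * e = a ^ Suc d * w" by (simp add: e_def mult.assoc)
  then have "e * (a * e) = a * e"
    by (metis e mult.assoc power_Suc2)
  then have "a ^ d * c * e * a * e = a ^ d * c * (a ^ Suc d * w)"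
    by (simp add: mult.assoc ae)
  also have "\<dots> = a ^ d * c * a ^ Suc d * w" by (simp only: mult.assoc)
  also have "\<dots> = e" by (simp add: c' e_def del: power_Suc)
  finally show ?thesis
    using e \<open>e * e = e\<close> by (intro exI[of _ e] exI[of _ "a ^ d * c * e"]) (simp add: mult.assoc)
qed

text \<open>On the hyperrange the element \<open>g = a\<^sup>d c\<close>, with \<open>c\<close> a generalised inverse of
  \<open>a\<^sup>d\<^sup>+\<^sup>1\<close>, is a right inverse of \<open>a\<close>.\<close>

lemma uniform_descent_kernel_chain:
  fixes a :: "'a::ring_1"
  assumes ud: "uniform_descent a d" and z: "a ^ Suc d * z = 0" "a ^ d * z \<noteq> 0"
  shows "\<exists>g u. u \<noteq> 0 \<and> a * u = 0 \<and> (\<forall>n. a * g ^ Suc n * u = g ^ n * u)"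
proof -
  \<comment> \<open>The hyperrange of \<open>a\<close>; restricting to \<open>m \<ge> d\<close> does
    not change it, as the ranges decrease.\<close>
  define H where "H = {y. \<forall>m\<ge>d. \<exists>w. y = a ^ m * w}"
  obtain c where c: "a ^ Suc d * c * a ^ Suc d = a ^ Suc d"
    using ud[unfolded uniform_descent_def, THEN conjunct1, rule_format, of "Suc d"]
    unfolding vn_regular_def by auto
  define g where "g = a ^ d * c"
  have ag: "a * (g * y) = y" if y: "y \<in> H" for y
  proof -
    obtain w where w: "y = a ^ Suc d * w"
      using y[unfolded H_def, THEN CollectD, rule_format, of "Suc d"] by auto
    have "a * (g * y) = a ^ Suc d * c * a ^ Suc d * w" by (simp add: g_def w mult.assoc)
    then show ?thesis using c w by simp
  qed
  have gH: "g * y \<in> H" if y: "y \<in> H" for y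
    unfolding H_def
  proof (intro CollectI allI impI)
    fix m assume m: "d \<le> m"
    then obtain w where w: "y = a ^ Suc m * w"
      using y[unfolded H_def, THEN CollectD, rule_format, of "Suc m"] by auto
    \<comment> \<open>Both \<open>a ^ m * w\<close> and \<open>g * y\<close> are preimages of
      \<open>y\<close> under \<open>a\<close>. Their difference \<open>a ^ d * v\<close> lies in
      R(a), so uniform descent moves it into \<open>a ^ m * A\<close>, and \<open>g * y\<close> with
      it.\<close>
    define v where "v = a ^ (m - d) * w - c * y"
    have v: "a ^ d * v = a ^ m * w - g * y"
      using m by (simp add: v_def g_def right_diff_distrib mult.assoc[symmetric] flip: power_add)
    then have "a ^ Suc d * v = 0"
      using ag[OF y] w by (simp add: mult.assoc right_diff_distrib)
    then obtain w' where "a ^ d * v = a ^ m * w'"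
      using ud m unfolding uniform_descent_def by blast
    then have "g * y = a ^ m * (w - w')" using v by (simp add: algebra_simps)
    then show "\<exists>w. g * y = a ^ m * w" ..
  qed
  define u where "u = a ^ d * z"
  have "u \<in> H" using ud z unfolding uniform_descent_def H_def u_def by blast
  then have "g ^ n * u \<in> H" for n
    by (induction n) (auto simp: mult.assoc intro: gH)
  then have "a * g ^ Suc n * u = g ^ n * u" for n
    using ag by (simp add: mult.assoc)
  moreover have "a * u = 0" using z by (simp add: u_def mult.assoc)
  ultimately show ?thesis using z by (auto simp: u_def)
qed

section \<open>The local dichotomy\<close>

lemma power_diff_right_factor:
  fixes a m :: "'a::ring_1"
  assumes "a * m = m * a"
  shows "\<exists>q. a ^ n - m ^ n = q * (a - m)"
proof (induction n)
  case (Suc n)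
  then obtain q where q: "a ^ n - m ^ n = q * (a - m)" ..
  have "a * m ^ n = m ^ n * a"
    using power_commuting_commutes[of m a n] assms by simp
  then have "a ^ Suc n - m ^ Suc n = a * (a ^ n - m ^ n) + m ^ n * (a - m)"
    by (simp add: algebra_simps power_commutes)
  then show ?case unfolding q by (metis distrib_right mult.assoc)
qed (auto intro: exI[of _ 0])

text \<open>On the range of \<open>e\<close>,
  \<open>h * (a - m) * e = (1 - \<mu> *\<^sub>C h) * e\<close> is handled by a Neumann series.
  Modulo \<open>e\<close> the power \<open>a ^ d\<close> vanishes, so the factorisation of
  \<open>a ^ d - m ^ d\<close> inverts \<open>a - m\<close> up to the scalar
  \<open>- (\<mu> ^ d)\<close>, whence the condition \<open>\<mu> \<noteq> 0\<close>.\<close>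

lemma left_invertible_near:
  fixes a :: "'a::complex_banach_algebra"
  assumes e: "e * a ^ d = a ^ d" and h: "h * a * e = e" "h * e = h"
    and \<mu>: "\<mu> \<noteq> 0" "cmod \<mu> * norm h < 1"
  shows "\<exists>y. y * (a - of_complex \<mu>) = 1"
proof -
  define m :: 'a where "m = of_complex \<mu>"
  obtain v where v: "v * (1 - \<mu> *\<^sub>C h) = 1"
    using neumann_series[of "\<mu> *\<^sub>C h"] \<mu>(2) by (auto simp: norm_scaleC)
  have "v * h * (a - m) * e = v * (h * a * e - \<mu> *\<^sub>C (h * e))"
    by (simp add: m_def of_complex_mult_left of_complex_mult_right algebra_simps mult_scaleC_left mult_scaleC_right)
  also have "\<dots> = v * (1 - \<mu> *\<^sub>C h) * e"
    by (simp add: h(2) right_diff_distrib left_diff_distrib mult_scaleC_left mult.assoc h(1)[unfolded mult.assoc])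
  finally have ve: "v * h * (a - m) * e = e" using v by simp
  obtain q where q: "a ^ d - m ^ d = q * (a - m)"
    using power_diff_right_factor[of a m d] by (auto simp: m_def of_complex_mult_left of_complex_mult_right)
  define p where "p = (- inverse (\<mu> ^ d)) *\<^sub>C ((1 - e) * q)"
  have "p * (a - m) = (- inverse (\<mu> ^ d)) *\<^sub>C ((1 - e) * (a ^ d - m ^ d))"
    by (simp add: p_def q mult_scaleC_left mult.assoc)
  also have "(1 - e) * (a ^ d - m ^ d) = - (\<mu> ^ d *\<^sub>C (1 - e))"
    by (simp add: algebra_simps e m_def of_complex_power of_complex_mult_right of_complex_mult_left
        complex_vector.scale_right_diff_distrib)
  finally have p: "p * (a - m) = 1 - e"
    using \<mu>(1) by (simp add: scaleC_scaleC scaleC_one)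
  define w where "w = v * h * (a - m)"
  \<comment> \<open>Gluing: \<open>p\<close> contributes \<open>1 - e\<close>, and the rest
    contributes \<open>w - w * (1 - e) = w * e = e\<close>.\<close>
  have "(p + v * h - w * p) * (a - m) = p * (a - m) + w - w * (p * (a - m))"
    by (simp only: distrib_right left_diff_distrib w_def mult.assoc)
  also have "\<dots> = 1"
    unfolding p using ve[folded w_def] by (simp add: right_diff_distrib)
  finally show ?thesis unfolding m_def by blast
qed

text \<open>Left inverses force \<open>f\<close> to vanish near \<open>\<alpha>\<close> off
  \<open>\<alpha>\<close>; the identity theorem spreads this over the connected set
  \<open>U\<close>, however far it reaches beyond the disc.\<close>

lemma left_SVEP_at_if_punctured:
  assumes "r > 0" and inv: "\<And>\<mu>. \<mu> \<in> ball \<alpha> r - {\<alpha>} \<Longrightarrow> \<mu> \<notin> left_spectrum x"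
  shows "left_SVEP_at x \<alpha>"
  unfolding left_SVEP_at_def
proof (intro allI impI ballI, elim conjE)
  fix U f z
  assume U: "open U" "connected U" "\<alpha> \<in> U" "vector_holomorphic_on f U" "z \<in> U"
    and f: "\<forall>\<mu>\<in>U. (of_complex \<mu> - x) * f \<mu> = 0"
  have "\<alpha> islimpt ball \<alpha> r \<inter> U"
    using U assms(1) by (intro interior_limit_point) (auto simp: interior_open open_Int)
  then have lim: "\<alpha> islimpt ball \<alpha> r \<inter> U - {\<alpha>}"
    by (simp add: islimpt_punctured[symmetric])
  have zero: "f w = 0" if w: "w \<in> ball \<alpha> r \<inter> U - {\<alpha>}" for w
  proof -
    obtain y where "y * (x - of_complex w) = 1"
      using inv[of w] w by (auto simp: left_spectrum_def)
    moreover have "(x - of_complex w) * f w = 0"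
      using f w by (auto simp: algebra_simps)
    ultimately show ?thesis by (metis mult.assoc mult_1 mult_zero_right)
  qed
  show "f z = 0"
    by (rule vector_holomorphic_identity[OF U(4,1,2) _ U(3) lim zero U(5)]) auto
qed

text \<open>One function serves all points of the ball: \<open>f\<close> lives on the whole ball and
  \<open>f \<alpha> = u\<close> is nonzero, while the SVEP at any point \<open>\<mu>\<close> of the
  ball would make \<open>f\<close> vanish throughout it.\<close>

lemma not_left_SVEP_at_near:
  fixes x :: "'a::complex_banach_algebra"
  assumes u: "u \<noteq> 0" "(x - of_complex \<alpha>) * u = 0"
    and chain: "\<And>n. (x - of_complex \<alpha>) * g ^ Suc n * u = g ^ n * u"
  shows "\<exists>r>0. \<forall>\<mu>\<in>ball \<alpha> r. \<not> left_SVEP_at x \<mu>"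
proof -
  define a where "a = x - of_complex \<alpha>"
  \<comment> \<open>The factor 2 keeps \<open>norm (\<mu> *\<^sub>C g)\<close> below
    \<open>1 / 2\<close> and so the resolvents below 2; the summand 1 avoids division by
    zero.\<close>
  define r where "r = 1 / (2 * (norm g + 1))"
  have r: "r > 0" by (simp add: r_def add_nonneg_pos)
  have small: "norm (\<mu> *\<^sub>C g) \<le> 1 / 2" if "cmod \<mu> < r" for \<mu>
  proof -
    have "cmod \<mu> * norm g \<le> r * (norm g + 1)" using that r by (intro mult_mono) auto
    also have "\<dots> = 1 / 2" using norm_ge_zero[of g] by (simp add: r_def field_simps add_nonneg_eq_0_iff)
    finally show ?thesis by (simp add: norm_scaleC)
  qed
  have "\<exists>w. w * (1 - \<mu> *\<^sub>C g) = 1 \<and> (1 - \<mu> *\<^sub>C g) * w = 1 \<and> norm w \<le> 2 \<and>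
      (\<forall>c u. (\<forall>n. c * (\<mu> *\<^sub>C g) ^ n * u = 0) \<longrightarrow> c * w * u = 0)" if \<mu>: "cmod \<mu> < r" for \<mu>
  proof -
    have "1 / (1 - norm (\<mu> *\<^sub>C g)) \<le> 2" using small[OF \<mu>] by (simp add: field_simps)
    then show ?thesis using neumann_series[of "\<mu> *\<^sub>C g"] small[OF \<mu>] by fastforce
  qed
  then obtain R where
      R1: "\<And>\<mu>. cmod \<mu> < r \<Longrightarrow> R \<mu> * (1 - \<mu> *\<^sub>C g) = 1"
    and R2: "\<And>\<mu>. cmod \<mu> < r \<Longrightarrow> (1 - \<mu> *\<^sub>C g) * R \<mu> = 1"
    and bound: "\<And>\<mu>. cmod \<mu> < r \<Longrightarrow> norm (R \<mu>) \<le> 2"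
    and R0: "\<And>\<mu> c u. cmod \<mu> < r \<Longrightarrow> (\<And>n. c * (\<mu> *\<^sub>C g) ^ n * u = 0) \<Longrightarrow> c * R \<mu> * u = 0"
    by metis
  have resolvent: "R \<mu> - R \<nu> = (\<mu> - \<nu>) *\<^sub>C (R \<mu> * g * R \<nu>)" if "cmod \<mu> < r" "cmod \<nu> < r" for \<mu> \<nu>
  proof -
    have "R \<mu> - R \<nu> = R \<mu> * ((1 - \<nu> *\<^sub>C g) * R \<nu>) - R \<mu> * (1 - \<mu> *\<^sub>C g) * R \<nu>"
      using R1[OF that(1)] R2[OF that(2)] by simp
    also have "\<dots> = (\<mu> - \<nu>) *\<^sub>C (R \<mu> * g * R \<nu>)"
      by (simp add: algebra_simps mult_scaleC_left mult_scaleC_right complex_vector.scale_left_diff_distrib)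
    finally show ?thesis .
  qed
  define f where "f \<zeta> = R (\<zeta> - \<alpha>) * u" for \<zeta>
  have "vector_holomorphic_on f (ball \<alpha> r)"
    unfolding vector_holomorphic_on_def
  proof
    fix z assume z: "z \<in> ball \<alpha> r"
    let ?d = "R (z - \<alpha>) * g * R (z - \<alpha>) * u"
    have rz: "cmod (w - \<alpha>) < r" if "w \<in> ball \<alpha> r" for w
      using that by (simp add: dist_norm norm_minus_commute)
    define K where "K = 2 * (norm g * norm ?d)"
    \<comment> \<open>The resolvent identity, used twice, leaves a quadratic remainder; the 2 in
      \<open>K\<close> is the uniform bound on the resolvents.\<close>
    have est: "norm (f w - f z - (w - z) *\<^sub>C ?d) \<le> K * norm (w - z) * norm (w - z)"
      if w: "w \<in> ball \<alpha> r" for w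
    proof -
      have "f w - f z = (w - z) *\<^sub>C (R (w - \<alpha>) * g * R (z - \<alpha>) * u)"
        using resolvent[OF rz[OF w] rz[OF z]]
        by (simp add: f_def mult_scaleC_left flip: left_diff_distrib)
      then have "f w - f z - (w - z) *\<^sub>C ?d
          = (w - z) *\<^sub>C ((R (w - \<alpha>) - R (z - \<alpha>)) * (g * R (z - \<alpha>) * u))"
        by (simp add: left_diff_distrib complex_vector.scale_right_diff_distrib mult.assoc)
      also have "\<dots> = (w - z) *\<^sub>C (w - z) *\<^sub>C (R (w - \<alpha>) * (g * ?d))"
        using resolvent[OF rz[OF w] rz[OF z]] by (simp add: mult_scaleC_left mult.assoc)
      finally have eq: "norm (f w - f z - (w - z) *\<^sub>C ?d)
          = norm (R (w - \<alpha>) * (g * ?d)) * norm (w - z) * norm (w - z)"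
        by (simp add: norm_scaleC norm_mult)
      have "norm (R (w - \<alpha>) * (g * ?d)) \<le> norm (R (w - \<alpha>)) * (norm g * norm ?d)"
        by (meson norm_mult_ineq mult_left_mono norm_ge_zero order_trans)
      also have "\<dots> \<le> K"
        unfolding K_def using bound[OF rz[OF w]] by (intro mult_right_mono) auto
      finally show ?thesis unfolding eq by (intro mult_right_mono norm_ge_zero)
    qed
    have "(f has_derivative (\<lambda>h. h *\<^sub>C ?d)) (at z within ball \<alpha> r)"
      unfolding has_derivative_within_alt
    proof (intro conjI allI impI)
      show "bounded_linear (\<lambda>h. h *\<^sub>C ?d)"
        by (rule bounded_linear_intro[of _ "norm ?d"])
          (simp_all add: scaleC_add_left norm_scaleC scaleR_conv_of_real[where 'a = complex] scaleC_scaleC flip: scaleC_of_real)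
      fix \<epsilon> :: real assume \<epsilon>: "\<epsilon> > 0"
      define \<delta> where "\<delta> = \<epsilon> / (K + 1)"
      have K: "K \<ge> 0" by (simp add: K_def)
      have "norm (f w - f z - (w - z) *\<^sub>C ?d) \<le> \<epsilon> * norm (w - z)"
        if w: "w \<in> ball \<alpha> r" "norm (w - z) < \<delta>" for w
      proof -
        have "K * norm (w - z) \<le> (K + 1) * \<delta>" using w K by (intro mult_mono) auto
        also have "\<dots> = \<epsilon>" using K by (simp add: \<delta>_def)
        finally show ?thesis using est[OF w(1)] by (meson mult_right_mono norm_ge_zero order_trans)
      qed
      moreover have "\<delta> > 0" using \<epsilon> K by (simp add: \<delta>_def)
      ultimately show "\<exists>\<delta>>0. \<forall>w\<in>ball \<alpha> r. norm (w - z) < \<delta> \<longrightarrow>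
          norm (f w - f z - (w - z) *\<^sub>C ?d) \<le> \<epsilon> * norm (w - z)" by blast
    qed
    then show "\<exists>d. (f has_derivative (\<lambda>h. h *\<^sub>C d)) (at z within ball \<alpha> r)" ..
  qed
  moreover have "(of_complex \<zeta> - x) * f \<zeta> = 0" if "\<zeta> \<in> ball \<alpha> r" for \<zeta>
  proof -
    define \<mu> where "\<mu> = \<zeta> - \<alpha>"
    have \<mu>: "cmod \<mu> < r" using that by (simp add: \<mu>_def dist_norm norm_minus_commute)
    have powers: "(\<mu> *\<^sub>C g) ^ n = \<mu> ^ n *\<^sub>C g ^ n" for n
      by (induction n) (simp_all add: scaleC_one mult_scaleC_left mult_scaleC_right scaleC_scaleC mult_ac)
    \<comment> \<open>\<open>a * g - 1\<close> kills every \<open>g ^ n * u\<close>, hence also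
      \<open>R \<mu> * u\<close>. With
      \<open>R \<mu> * u = u + \<mu> *\<^sub>C (g * R \<mu> * u)\<close> and
      \<open>a * u = 0\<close> this makes \<open>R \<mu> * u\<close> an eigenvector of
      \<open>a\<close> for \<open>\<mu>\<close>.\<close>
    have "(a * g - 1) * (\<mu> *\<^sub>C g) ^ n * u = \<mu> ^ n *\<^sub>C (a * g ^ Suc n * u - g ^ n * u)" for n
      by (simp add: powers algebra_simps mult_scaleC_left mult_scaleC_right
          complex_vector.scale_right_diff_distrib)
    then have "(a * g - 1) * R \<mu> * u = 0"
      using chain by (intro R0[OF \<mu>]) (simp add: a_def)
    then have "a * g * R \<mu> * u = R \<mu> * u" by (simp add: algebra_simps)
    moreover have "R \<mu> * u = u + \<mu> *\<^sub>C (g * R \<mu> * u)"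
    proof -
      have "((1 - \<mu> *\<^sub>C g) * R \<mu>) * u = u" using R2[OF \<mu>] by simp
      then show ?thesis by (simp add: algebra_simps mult_scaleC_left)
    qed
    ultimately have "a * (R \<mu> * u) = a * u + \<mu> *\<^sub>C (R \<mu> * u)"
      by (metis distrib_left mult.assoc mult_scaleC_right)
    then have "(a - of_complex \<mu>) * f \<zeta> = 0"
      using u by (simp add: f_def \<mu>_def[symmetric] a_def left_diff_distrib of_complex_mult_left)
    moreover have "of_complex \<zeta> - x = - (a - of_complex \<mu>)"
      by (simp add: a_def \<mu>_def of_complex_diff)
    ultimately show ?thesis by (simp only: mult_minus_left minus_zero)
  qed
  moreover have "f \<alpha> \<noteq> 0"
    using R1[of 0] r u by (simp add: f_def)
  moreover have "\<alpha> \<in> ball \<alpha> r" using r by simp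
  ultimately have "\<not> left_SVEP_at x \<mu>" if "\<mu> \<in> ball \<alpha> r" for \<mu>
    unfolding left_SVEP_at_def using that open_ball connected_ball by blast
  with r show ?thesis by blast
qed

section \<open>Finite and infinite ascent at a single point\<close>

lemma Inf_enat_image_finite: "Inf (enat ` N) < \<infinity> \<longleftrightarrow> N \<noteq> {}"
proof
  assume "N \<noteq> {}"
  then obtain n where "n \<in> N" by blast
  then have "Inf (enat ` N) \<le> enat n" by (intro Inf_lower) simp
  then show "Inf (enat ` N) < \<infinity>" by (rule le_less_trans) simp
qed (auto simp: top_enat_def)

lemma p_l_finite: "p_l x < \<infinity> \<longleftrightarrow> (\<exists>n. right_annihilator (x ^ n) = right_annihilator (x ^ (n + 1)))"
  unfolding p_l_def Inf_enat_image_finite by blast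

lemma q_l_finite: "q_l x < \<infinity> \<longleftrightarrow> (\<exists>n. range (\<lambda>a. x ^ n * a) = range (\<lambda>a. x ^ (n + 1) * a))"
  unfolding q_l_def Inf_enat_image_finite by blast

lemma uniform_descent_dichotomy:
  assumes ud: "uniform_descent (x - of_complex \<alpha>) d"
  shows "p_l (x - of_complex \<alpha>) < \<infinity> \<Longrightarrow> \<exists>r>0. \<forall>\<mu>\<in>ball \<alpha> r - {\<alpha>}. \<mu> \<notin> left_spectrum x" (is "?fin \<Longrightarrow> _")
    and "p_l (x - of_complex \<alpha>) = \<infinity> \<Longrightarrow> \<exists>r>0. \<forall>\<mu>\<in>ball \<alpha> r. \<not> left_SVEP_at x \<mu>" (is "?inf \<Longrightarrow> _")
proof -
  define a where "a = x - of_complex \<alpha>"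
  have reg: "vn_regular (a ^ n)" if "n \<ge> d" for n
    using ud that by (simp add: uniform_descent_def a_def)
  {
    assume ?fin
    then obtain n where "right_annihilator (a ^ n) = right_annihilator (a ^ (n + 1))"
      unfolding p_l_finite a_def by blast
    then have "\<And>z. a ^ Suc n * z = 0 \<Longrightarrow> a ^ n * z = 0"
      by (auto simp: right_annihilator_def)
    \<comment> \<open>The exponent \<open>n + d\<close> lies beyond both the ascent and the
      threshold for regularity.\<close>
    then have "\<And>z. a ^ Suc (n + d) * z = 0 \<Longrightarrow> a ^ (n + d) * z = 0"
      by (rule power_annihilator_mono) auto
    then obtain e h where eh: "e * a ^ (n + d) = a ^ (n + d)" "h * a * e = e" "h * e = h"
      using injective_on_range_left_inverse[of a "n + d"] reg[of "n + d"] reg[of "Suc (n + d)"]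
      by (simp del: power_Suc) metis
    define r where "r = 1 / (norm h + 1)"
    have r: "r > 0" by (simp add: r_def add_nonneg_pos)
    have "\<mu> \<notin> left_spectrum x" if \<mu>: "\<mu> \<in> ball \<alpha> r - {\<alpha>}" for \<mu>
    proof -
      have "cmod (\<mu> - \<alpha>) < r" using \<mu> by (simp add: dist_norm norm_minus_commute)
      then have "cmod (\<mu> - \<alpha>) * (norm h + 1) < 1"
        using norm_ge_zero[of h] by (simp add: r_def field_simps add_nonneg_pos)
      then have "cmod (\<mu> - \<alpha>) * norm h < 1"
        using norm_ge_zero[of "\<mu> - \<alpha>"] unfolding distrib_left by linarith
      then have "\<exists>y. y * (a - of_complex (\<mu> - \<alpha>)) = 1"
        using left_invertible_near[OF eh] \<mu> by simp
      then show ?thesis by (simp add: left_spectrum_def a_def of_complex_diff)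
    qed
    with r show "\<exists>r>0. \<forall>\<mu>\<in>ball \<alpha> r - {\<alpha>}. \<mu> \<notin> left_spectrum x" by blast
  next
    assume ?inf
    then have "right_annihilator (a ^ d) \<noteq> right_annihilator (a ^ (d + 1))"
      using p_l_finite[of a] by (auto simp: a_def)
    moreover have "a ^ (d + 1) * z = 0" if "a ^ d * z = 0" for z
      using that by (simp add: mult.assoc)
    ultimately obtain z where "a ^ Suc d * z = 0" "a ^ d * z \<noteq> 0"
      unfolding right_annihilator_def by auto
    then obtain g u where "u \<noteq> 0" "a * u = 0" "\<forall>n. a * g ^ Suc n * u = g ^ n * u"
      using uniform_descent_kernel_chain ud unfolding a_def by blast
    then show "\<exists>r>0. \<forall>\<mu>\<in>ball \<alpha> r. \<not> left_SVEP_at x \<mu>"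
      unfolding a_def by (intro not_left_SVEP_at_near) auto
  }
qed

section \<open>The socle of a semiprime algebra\<close>

lemma right_idealD:
  assumes "right_ideal J"
  shows "0 \<in> J" "x \<in> J \<Longrightarrow> y \<in> J \<Longrightarrow> x + y \<in> J" "x \<in> J \<Longrightarrow> y \<in> J \<Longrightarrow> x - y \<in> J"
    "x \<in> J \<Longrightarrow> x * a \<in> J" "x \<in> J \<Longrightarrow> c *\<^sub>C x \<in> J"
  using assms complex_vector.subspace_0 complex_vector.subspace_add complex_vector.subspace_diff
    complex_vector.subspace_scale
  by (auto simp: right_ideal_def)

lemma right_idealI:
  assumes "0 \<in> J" "\<And>x y. x \<in> J \<Longrightarrow> y \<in> J \<Longrightarrow> x + y \<in> J" "\<And>x a. x \<in> J \<Longrightarrow> x * a \<in> J"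
  shows "right_ideal J"
  unfolding right_ideal_def complex_vector.subspace_def
  using assms by (metis of_complex_mult_right)

lemma right_ideal_zero: "right_ideal {0}"
  by (rule right_idealI) auto

lemma right_ideal_principal: "right_ideal (range ((*) u))"
  by (rule right_idealI) (auto simp: mult.assoc simp flip: distrib_left intro: range_eqI[of _ _ 0])

text \<open>A right ideal of finite length, witnessed by any strictly monotone natural-number valued
  function on its right subideals.\<close>

definition finite_length :: "'a::complex_banach_algebra set \<Rightarrow> bool" where
  "finite_length S \<longleftrightarrow> right_ideal S \<and> (\<exists>l::'a set \<Rightarrow> nat.
     \<forall>K L. right_ideal K \<and> right_ideal L \<and> K \<subset> L \<and> L \<subseteq> S \<longrightarrow> l K < l L)"

lemma finite_length_zero: "finite_length {0}"
  unfolding finite_length_def using right_ideal_zero right_idealD(1) by blast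

text \<open>\<open>P K\<close> collects the \<open>J\<close>-components of elements of
  \<open>K\<close>; the sum need not be direct, so this is a relation, not a projection. It is
  \<open>{0}\<close> or \<open>J\<close> by minimality and adds 0 or 1 to the length of
  \<open>K \<inter> S\<close>.\<close>

lemma finite_length_add_minimal:
  assumes S: "finite_length S" and J: "minimal_right_ideal J"
  shows "finite_length {s + j | s j. s \<in> S \<and> j \<in> J}" (is "finite_length ?T")
proof -
  note rS = right_idealD[OF S[unfolded finite_length_def, THEN conjunct1]]
  have "right_ideal J" using J by (simp add: minimal_right_ideal_def)
  note rJ = right_idealD[OF this]
  have T: "right_ideal ?T"
  proof (rule right_idealI)
    show "0 \<in> ?T" using rS(1) rJ(1) by force
    show "x + y \<in> ?T" if "x \<in> ?T" "y \<in> ?T" for x y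
      using that rS(2) rJ(2) by clarsimp (metis add.assoc add.left_commute)
    show "x * a \<in> ?T" if "x \<in> ?T" for x a
      using that rS(4) rJ(4) by clarsimp (metis distrib_right)
  qed
  define P where "P K = {j \<in> J. \<exists>s\<in>S. s + j \<in> K}" for K
  have P_ideal: "right_ideal (P K)" if K: "right_ideal K" for K
  proof (rule right_idealI)
    note rK = right_idealD[OF K]
    show "0 \<in> P K" using rS(1) rJ(1) rK(1) by (force simp: P_def)
    show "x + y \<in> P K" if "x \<in> P K" "y \<in> P K" for x y
    proof -
      obtain s t where "s \<in> S" "s + x \<in> K" "t \<in> S" "t + y \<in> K" using \<open>x \<in> P K\<close> \<open>y \<in> P K\<close> by (auto simp: P_def)
      then have "s + t \<in> S" "(s + t) + (x + y) \<in> K"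
        using rS(2) rK(2)[of "s + x" "t + y"] by (auto simp: algebra_simps)
      then show ?thesis using \<open>x \<in> P K\<close> \<open>y \<in> P K\<close> rJ(2) by (auto simp: P_def)
    qed
    show "x * a \<in> P K" if "x \<in> P K" for x a
      using that rS(4) rJ(4) rK(4) by (auto simp: P_def) (metis distrib_right)
  qed
  have P_cases: "P K = {0} \<or> P K = J" if "right_ideal K" for K
    using J P_ideal[OF that] by (auto simp: minimal_right_ideal_def P_def)
  have J0: "J \<noteq> {0}" using J by (simp add: minimal_right_ideal_def)
  obtain l :: "'a set \<Rightarrow> nat" where
    l: "\<And>K L. right_ideal K \<Longrightarrow> right_ideal L \<Longrightarrow> K \<subset> L \<Longrightarrow> L \<subseteq> S \<Longrightarrow> l K < l L"
    using S unfolding finite_length_def by metis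
  define l' where "l' K = l (K \<inter> S) + (if P K = J then 1 else 0)" for K
  have "l' K < l' L" if K: "right_ideal K" and L: "right_ideal L" and KL: "K \<subset> L" "L \<subseteq> ?T" for K L
  proof -
    have int: "right_ideal (M \<inter> S)" if "right_ideal M" for M
      using right_idealD[OF that] rS by (intro right_idealI) auto
    have Int: "l (K \<inter> S) < l (L \<inter> S) \<or> K \<inter> S = L \<inter> S"
      using l[OF int[OF K] int[OF L]] KL by blast
    have P_mono: "P K \<subseteq> P L" using KL by (auto simp: P_def)
    \<comment> \<open>The modular law: if \<open>s + j\<close> is in \<open>L\<close> and
      \<open>t + j\<close> in \<open>K\<close>, then \<open>s - t\<close> lies in
      \<open>L \<inter> S = K \<inter> S\<close>, so \<open>s + j\<close> is in
      \<open>K\<close>.\<close>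
    have "P K \<noteq> P L" if eq: "K \<inter> S = L \<inter> S"
    proof
      assume PP: "P K = P L"
      have "L \<subseteq> K"
      proof
        fix k assume k: "k \<in> L"
        then obtain s j where sj: "k = s + j" "s \<in> S" "j \<in> J" using k KL(2) by blast
        then have "j \<in> P K" using k PP by (auto simp: P_def)
        then obtain t where t: "t \<in> S" "t + j \<in> K" by (auto simp: P_def)
        then have "(s + j) - (t + j) \<in> L"
          using k sj KL by (intro right_idealD(3)[OF L]) auto
        then have "s - t \<in> L \<inter> S" using rS(3) sj t by simp
        then have "s - t \<in> K" using eq by blast
        then have "(s - t) + (t + j) \<in> K" using t(2) by (rule right_idealD(2)[OF K])
        then show "k \<in> K" unfolding sj(1) by (simp only: add.assoc[symmetric] diff_add_cancel)
      qed
      with KL show False by blast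
    qed
    then show ?thesis
      using Int P_cases[OF K] P_cases[OF L] P_mono J0 rJ(1) unfolding l'_def by auto
  qed
  then show ?thesis unfolding finite_length_def using T by blast
qed

lemma soc_finite_length:
  assumes "s \<in> soc"
  shows "\<exists>S. finite_length S \<and> s \<in> S"
  using assms unfolding soc_def
proof (induction rule: complex_vector.span_induct_alt)
  case base
  show ?case using finite_length_zero by blast
next
  case (step c x y)
  then obtain J S where "minimal_right_ideal J" "x \<in> J" "finite_length S" "y \<in> S" by auto
  then have "finite_length {s + j | s j. s \<in> S \<and> j \<in> J}" "c *\<^sub>C x \<in> J"
    by (auto simp: finite_length_add_minimal minimal_right_ideal_def intro: right_idealD)
  moreover have "c *\<^sub>C x + y \<in> {s + j | s j. s \<in> S \<and> j \<in> J}"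
    using \<open>y \<in> S\<close> \<open>c *\<^sub>C x \<in> J\<close> add.commute by blast
  ultimately show ?case by blast
qed

lemma soc_add: "x \<in> soc \<Longrightarrow> y \<in> soc \<Longrightarrow> x + y \<in> soc"
  and soc_zero: "0 \<in> soc"
  by (auto simp: soc_def complex_vector.span_add complex_vector.span_zero)

lemma soc_mult_right: "s \<in> soc \<Longrightarrow> s * a \<in> soc"
  unfolding soc_def
proof (induction rule: complex_vector.span_induct_alt)
  case (step c x y)
  then obtain J where "minimal_right_ideal J" "x \<in> J" by auto
  then have "minimal_right_ideal J" "c *\<^sub>C x * a \<in> J"
    by (auto simp: minimal_right_ideal_def intro: right_idealD)
  then have "c *\<^sub>C x * a \<in> complex_vector.span (\<Union> {J. minimal_right_ideal J})"
    by (intro complex_vector.span_base) auto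
  with step.IH show ?case by (simp add: distrib_right complex_vector.span_add)
qed (simp add: complex_vector.span_zero)

text \<open>Left multiplication by \<open>t\<close> is a homomorphism of right modules, so the
  preimage in \<open>J\<close> of a right subideal is \<open>{0}\<close> or \<open>J\<close>. This
  makes the socle, defined by right ideals, a left ideal as well.\<close>

lemma minimal_right_ideal_translate:
  assumes J: "minimal_right_ideal J" and t: "(*) t ` J \<noteq> {0}"
  shows "minimal_right_ideal ((*) t ` J)"
proof -
  have rJ: "right_ideal J" using J by (simp add: minimal_right_ideal_def)
  have "right_ideal ((*) t ` J)"
    using right_idealD[OF rJ] by (intro right_idealI) (auto simp: mult.assoc simp flip: distrib_left intro: image_eqI[of _ _ 0])
  moreover have "K = {0} \<or> K = (*) t ` J" if K: "right_ideal K" "K \<subseteq> (*) t ` J" for K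
  proof -
    have "right_ideal {j \<in> J. t * j \<in> K}"
      using right_idealD[OF rJ] right_idealD[OF K(1)]
      by (intro right_idealI) (auto simp: distrib_left simp flip: mult.assoc)
    then have "{j \<in> J. t * j \<in> K} = {0} \<or> {j \<in> J. t * j \<in> K} = J"
      using J by (auto simp: minimal_right_ideal_def)
    then show ?thesis
    proof
      assume "{j \<in> J. t * j \<in> K} = {0}"
      moreover have "\<exists>j\<in>J. t * j \<in> K \<and> y = t * j" if "y \<in> K" for y
        using K(2) that by blast
      ultimately have "y = 0" if "y \<in> K" for y
        using that by (metis (mono_tags, lifting) CollectI mult_zero_right singletonD)
      then show ?thesis using right_idealD(1)[OF K(1)] by blast
    qed (use K(2) in blast)
  qed
  ultimately show ?thesis using t by (simp add: minimal_right_ideal_def)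
qed

lemma soc_mult_left: "s \<in> soc \<Longrightarrow> t * s \<in> soc"
  unfolding soc_def
proof (induction rule: complex_vector.span_induct_alt)
  case (step c x y)
  let ?M = "\<Union> {J. minimal_right_ideal J}"
  obtain J where J: "minimal_right_ideal J" "x \<in> J" using step.hyps by auto
  then have "t * x \<in> complex_vector.span ?M"
  proof (cases "(*) t ` J = {0}")
    case True
    with J show ?thesis by (metis complex_vector.span_zero imageI singletonD)
  next
    case False
    with J show ?thesis by (intro complex_vector.span_base) (use minimal_right_ideal_translate in blast)
  qed
  then have "t * (c *\<^sub>C x) \<in> complex_vector.span ?M"
    by (simp add: mult_scaleC_right complex_vector.span_scale)
  with step.IH show ?case by (simp add: distrib_left complex_vector.span_add)
qed (simp add: complex_vector.span_zero)

text \<open>Brauer's lemma. Once some \<open>u * v\<close> with \<open>u\<close>, \<open>v\<close>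
  in \<open>J\<close> is nonzero, left multiplication by \<open>u\<close> is a bijection of
  \<open>J\<close> onto itself; the preimage \<open>e\<close> of \<open>u\<close> is idempotent
  because \<open>u * (e * e - e) = 0\<close>.\<close>

lemma minimal_right_ideal_idempotent:
  fixes J :: "'a::complex_banach_algebra set"
  assumes semiprime: "semiprime_algebra TYPE('a)" and J: "minimal_right_ideal J"
  shows "\<exists>e\<in>J. e * e = e \<and> e \<noteq> 0"
proof -
  have rJ: "right_ideal J" and "J \<noteq> {0}" using J by (auto simp: minimal_right_ideal_def)
  note rJD = right_idealD[OF rJ]
  have "\<exists>u\<in>J. \<exists>v\<in>J. u * v \<noteq> 0"
  proof (rule ccontr)
    assume *: "\<not> (\<exists>u\<in>J. \<exists>v\<in>J. u * v \<noteq> 0)"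
    \<comment> \<open>The two-sided ideal generated by \<open>J\<close>. Since
      \<open>j * (a * i) = (j * a) * i\<close> with \<open>j * a\<close> in \<open>J\<close>,
      vanishing products in \<open>J\<close> give \<open>T\<close> square zero, and semiprimeness
      applies.\<close>
    define T where "T = complex_vector.span {a * j | a j. j \<in> J}"
    have mult_left: "b * t \<in> T" and mult_right: "t * b \<in> T" if "t \<in> T" for b t
    proof -
      show "b * t \<in> T" using that unfolding T_def
      proof (induction rule: complex_vector.span_induct_alt)
        case (step c x y)
        then obtain a j where "x = a * j" "j \<in> J" by auto
        then have "b * x = (b * a) * j" by (simp add: mult.assoc)
        with \<open>j \<in> J\<close> have "b * x \<in> complex_vector.span {a * j | a j. j \<in> J}"
          by (intro complex_vector.span_base) blast
        then have "b * (c *\<^sub>C x) \<in> complex_vector.span {a * j | a j. j \<in> J}"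
          by (simp add: mult_scaleC_right complex_vector.span_scale)
        with step.IH show ?case by (simp add: distrib_left complex_vector.span_add)
      qed (simp add: complex_vector.span_zero)
      show "t * b \<in> T" using that unfolding T_def
      proof (induction rule: complex_vector.span_induct_alt)
        case (step c x y)
        then obtain a j where "x = a * j" "j \<in> J" by auto
        then have "x * b = a * (j * b)" "j * b \<in> J" by (simp_all add: mult.assoc rJD(4))
        then have "x * b \<in> complex_vector.span {a * j | a j. j \<in> J}"
          by (intro complex_vector.span_base) blast
        then have "c *\<^sub>C x * b \<in> complex_vector.span {a * j | a j. j \<in> J}"
          by (simp add: mult_scaleC_left complex_vector.span_scale)
        with step.IH show ?case by (simp add: distrib_right complex_vector.span_add)
      qed (simp add: complex_vector.span_zero)
    qed
    have annih: "j * t = 0" if "j \<in> J" "t \<in> T" for j t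
      using that(2) unfolding T_def
    proof (induction rule: complex_vector.span_induct_alt)
      case (step c x y)
      then obtain a i where "x = a * i" "i \<in> J" by auto
      then have "j * (c *\<^sub>C x) = 0"
        using * rJD(4)[OF \<open>j \<in> J\<close>, of a] by (simp add: mult_scaleC_right flip: mult.assoc)
      with step.IH show ?case by (simp add: distrib_left)
    qed simp
    have "s * t = 0" if "s \<in> T" "t \<in> T" for s t
      using that(1) unfolding T_def
    proof (induction rule: complex_vector.span_induct_alt)
      case (step c x y)
      then obtain a i where "x = a * i" "i \<in> J" by auto
      then have "c *\<^sub>C x * t = 0"
        using annih[OF _ \<open>t \<in> T\<close>] by (simp add: mult_scaleC_left mult.assoc)
      with step.IH show ?case by (simp add: distrib_right)
    qed simp
    moreover have "0 \<in> T" by (simp add: T_def complex_vector.span_zero)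
    ultimately have "{a * b | a b. a \<in> T \<and> b \<in> T} = {0}" by force
    then have "ideal_product T T = {0}"
      by (simp add: ideal_product_def complex_vector.span_insert_0)
    moreover have "two_sided_ideal T"
      using mult_left mult_right
      by (simp add: two_sided_ideal_def left_ideal_def right_ideal_def) (simp add: T_def)
    ultimately have "T = {0}" using semiprime unfolding semiprime_algebra_def by blast
    moreover have "J \<subseteq> T"
    proof
      fix j assume "j \<in> J"
      then have "1 * j \<in> T" unfolding T_def by (intro complex_vector.span_base) blast
      then show "j \<in> T" by simp
    qed
    ultimately show False using \<open>J \<noteq> {0}\<close> rJD(1) by blast
  qed
  then obtain u v where uv: "u \<in> J" "v \<in> J" "u * v \<noteq> 0" by blast
  then have "minimal_right_ideal ((*) u ` J)"
    by (intro minimal_right_ideal_translate[OF J]) auto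
  moreover have "(*) u ` J \<subseteq> J" using rJD(4) uv by auto
  ultimately have "(*) u ` J = J"
    using J unfolding minimal_right_ideal_def by meson
  then obtain e where e: "e \<in> J" "u * e = u" using uv by (metis imageE)
  have "right_ideal {j \<in> J. u * j = 0}"
    using rJD by (intro right_idealI) (auto simp: distrib_left simp flip: mult.assoc)
  then have "{j \<in> J. u * j = 0} = {0}"
    using J uv unfolding minimal_right_ideal_def by blast
  moreover have "e * e - e \<in> {j \<in> J. u * j = 0}"
    using e rJD by (simp add: right_diff_distrib flip: mult.assoc)
  ultimately have "e * e = e" by auto
  moreover have "e \<noteq> 0" using e uv by auto
  ultimately show ?thesis using e by blast
qed

text \<open>A nonzero right subideal of \<open>K\<close> of least length is a minimal right ideal,
  to which Brauer's lemma applies.\<close>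

lemma finite_length_idempotent:
  fixes S :: "'a::complex_banach_algebra set"
  assumes semiprime: "semiprime_algebra TYPE('a)" and S: "finite_length S"
    and K: "right_ideal K" "K \<subseteq> S" "K \<noteq> {0}"
  shows "\<exists>e\<in>K. e * e = e \<and> e \<noteq> 0"
proof -
  obtain l :: "'a set \<Rightarrow> nat" where
    l: "\<And>K L. right_ideal K \<Longrightarrow> right_ideal L \<Longrightarrow> K \<subset> L \<Longrightarrow> L \<subseteq> S \<Longrightarrow> l K < l L"
    using S unfolding finite_length_def by metis
  obtain J where J: "right_ideal J \<and> J \<subseteq> K \<and> J \<noteq> {0}"
    and min: "\<And>L. right_ideal L \<and> L \<subseteq> K \<and> L \<noteq> {0} \<Longrightarrow> l J \<le> l L"
    using ex_has_least_nat[of "\<lambda>J. right_ideal J \<and> J \<subseteq> K \<and> J \<noteq> {0}" K l] K by blast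
  have "L = {0} \<or> L = J" if "right_ideal L" "L \<subseteq> J" for L
  proof (rule ccontr)
    assume "\<not> (L = {0} \<or> L = J)"
    with that J K(2) have "l L < l J" "l J \<le> l L"
      by (auto intro!: l min)
    then show False by simp
  qed
  with J have "minimal_right_ideal J" by (simp add: minimal_right_ideal_def)
  from minimal_right_ideal_idempotent[OF semiprime this] J show ?thesis by blast
qed

text \<open>Among the idempotents of \<open>s A\<close> choose one with \<open>{k \<in> s A. e k = 0}\<close> of minimal length;
  a nonzero idempotent \<open>f\<close> in that set would yield the better choice \<open>e + f - f e\<close>.\<close>

lemma soc_vn_regular:
  fixes s :: "'a::complex_banach_algebra"
  assumes semiprime: "semiprime_algebra TYPE('a)" and s: "s \<in> soc"
  shows "vn_regular s"
proof -
  obtain S where S: "finite_length S" "s \<in> S" using soc_finite_length[OF s] by blast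
  obtain l :: "'a set \<Rightarrow> nat" where
    l: "\<And>K L. right_ideal K \<Longrightarrow> right_ideal L \<Longrightarrow> K \<subset> L \<Longrightarrow> L \<subseteq> S \<Longrightarrow> l K < l L"
    using S unfolding finite_length_def by metis
  define K where "K = range ((*) s)"
  have K: "right_ideal K" by (simp add: K_def right_ideal_principal)
  note rK = right_idealD[OF K]
  have KS: "K \<subseteq> S"
    using S right_idealD(4)[of S s] by (auto simp: K_def finite_length_def)
  define N where "N e = {k \<in> K. e * k = 0}" for e
  have N: "right_ideal (N e)" for e
    unfolding N_def using rK by (intro right_idealI) (auto simp: distrib_left simp flip: mult.assoc)
  obtain e where e: "e \<in> K" "e * e = e"
    and min: "\<And>f. f \<in> K \<Longrightarrow> f * f = f \<Longrightarrow> l (N e) \<le> l (N f)"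
    using ex_has_least_nat[of "\<lambda>e. e \<in> K \<and> e * e = e" 0 "\<lambda>e. l (N e)"] rK(1) by auto
  have "N e = {0}"
  proof (rule ccontr)
    assume "N e \<noteq> {0}"
    moreover have "N e \<subseteq> S" using KS by (auto simp: N_def)
    ultimately obtain f where f: "f \<in> N e" "f * f = f" "f \<noteq> 0"
      using finite_length_idempotent[OF semiprime S(1) N] by blast
    then have ef: "e * f = 0" "f \<in> K" by (auto simp: N_def)
    define g where "g = e + f - f * e"
    have ge: "g * e = e" and gf: "g * f = f"
      using e f ef by (simp_all add: g_def algebra_simps)
    have eg: "e * g = e"
      using e ef by (simp add: g_def algebra_simps) (metis ef(1) mult.assoc mult_zero_left)
    have "g * g = g * e + g * f - g * f * e" by (simp add: g_def algebra_simps)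
    then have "g * g = g" by (simp add: ge gf) (simp add: g_def)
    moreover have "g \<in> K" using e ef rK by (simp add: g_def)
    ultimately have "l (N e) \<le> l (N g)" using min by blast
    moreover have "N g \<subset> N e"
    proof
      show "N g \<subseteq> N e"
        using eg by (auto simp: N_def) (metis mult.assoc mult_zero_right)
      have "f \<notin> N g" using f gf by (simp add: N_def)
      with f show "N g \<noteq> N e" by blast
    qed
    then have "l (N g) < l (N e)" using N KS by (intro l) (auto simp: N_def)
    ultimately show False by simp
  qed
  moreover have "s \<in> K" unfolding K_def by (metis mult_1_right rangeI)
  then have "s - e * s \<in> N e"
    using e rK by (simp add: N_def right_diff_distrib flip: mult.assoc)
  ultimately have "e * s = s" by auto
  moreover obtain t where "e = s * t" using e by (auto simp: K_def)
  ultimately show ?thesis by (auto simp: vn_regular_def)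
qed

text \<open>Modulo the socle the hypotheses iterate to \<open>a ^ k = b ^ j * a ^ (k + j)\<close>
  and \<open>a ^ k = a ^ (k + j) * c ^ j\<close>. Both together give regularity of the powers; the
  left-hand one confines the chain R(a) \<inter> \<open>a ^ n * A\<close> to a right ideal of finite
  length.\<close>

lemma uniform_descent_mod_soc:
  fixes a :: "'a::complex_banach_algebra"
  assumes semiprime: "semiprime_algebra TYPE('a)"
    and b: "a ^ k - b * a ^ Suc k \<in> soc" and c: "a ^ k - a ^ Suc k * c \<in> soc"
  shows "\<exists>d. uniform_descent a d"
proof -
  have b': "a ^ k - b ^ j * a ^ (k + j) \<in> soc" for j
  proof (induction j)
    case (Suc j)
    have "b ^ j * (a ^ k - b * a ^ Suc k) * a ^ j \<in> soc"
      by (intro soc_mult_left soc_mult_right b)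
    moreover have "b ^ j * (a ^ k - b * a ^ Suc k) * a ^ j
        = b ^ j * (a ^ k * a ^ j) - b ^ j * b * (a ^ Suc k * a ^ j)"
      by (simp only: right_diff_distrib left_diff_distrib mult.assoc)
    then have "b ^ j * (a ^ k - b * a ^ Suc k) * a ^ j = b ^ j * a ^ (k + j) - b ^ Suc j * a ^ (k + Suc j)"
      by (simp only: power_Suc2[of b] add_Suc_shift flip: power_add)
    ultimately show ?case using soc_add[OF Suc] by fastforce
  qed (simp add: soc_zero)
  have c': "a ^ k - a ^ (k + j) * c ^ j \<in> soc" for j
  proof (induction j)
    case (Suc j)
    have "a ^ j * (a ^ k - a ^ Suc k * c) * c ^ j \<in> soc"
      by (intro soc_mult_left soc_mult_right c)
    moreover have "a ^ j * (a ^ k - a ^ Suc k * c) * c ^ j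
        = a ^ j * a ^ k * c ^ j - a ^ j * a ^ Suc k * (c * c ^ j)"
      by (simp only: right_diff_distrib left_diff_distrib mult.assoc)
    then have "a ^ j * (a ^ k - a ^ Suc k * c) * c ^ j = a ^ (k + j) * c ^ j - a ^ (k + Suc j) * c ^ Suc j"
      by (simp only: power_Suc[of c] add_Suc_right add_Suc add.commute[of j] flip: power_add)
    ultimately show ?case using soc_add[OF Suc] by fastforce
  qed (simp add: soc_zero)
  have regular: "vn_regular (a ^ n)" if n: "n \<ge> k" for n
  proof -
    have pow: "a ^ n = a ^ (n - k) * a ^ k" "a ^ n = a ^ k * a ^ (n - k)"
      "a ^ n * a ^ n = a ^ (k + n) * a ^ (n - k)" "a ^ n * a ^ n = a ^ (n - k) * a ^ (k + n)"
      using n by (simp_all flip: power_add)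
    have "a ^ (n - k) * (a ^ k - a ^ (k + n) * c ^ n) \<in> soc"
      by (intro soc_mult_left c')
    then have 1: "a ^ n - a ^ n * a ^ n * c ^ n \<in> soc"
      by (simp add: right_diff_distrib pow(4) mult.assoc flip: pow(1))
    have 2: "(a ^ k - b ^ n * a ^ (k + n)) * a ^ (n - k) \<in> soc"
      by (intro soc_mult_right b')
    then have 2: "a ^ n - b ^ n * (a ^ n * a ^ n) \<in> soc"
      by (simp add: left_diff_distrib pow(3) mult.assoc flip: pow(2))
    have 3: "a ^ n * (a ^ n - b ^ n * (a ^ n * a ^ n)) * c ^ n \<in> soc"
      by (intro soc_mult_left soc_mult_right 2)
    have 4: "- (a ^ n * b ^ n) * (a ^ n - a ^ n * a ^ n * c ^ n) \<in> soc"
      by (rule soc_mult_left[OF 1])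
    \<comment> \<open>Modulo the socle, \<open>a ^ n = a ^ n * a ^ n * c ^ n = a ^ n * b ^ n * a ^ n
      * a ^ n * c ^ n = a ^ n * b ^ n * a ^ n\<close>, so \<open>b ^ n\<close> is a generalised
      inverse there and McCoy's lemma lifts it.\<close>
    have 5: "a ^ n - a ^ n * a ^ n * c ^ n + (a ^ n * (a ^ n - b ^ n * (a ^ n * a ^ n)) * c ^ n
        + - (a ^ n * b ^ n) * (a ^ n - a ^ n * a ^ n * c ^ n)) = a ^ n - a ^ n * b ^ n * a ^ n"
      by (simp add: algebra_simps)
    have "a ^ n - a ^ n * b ^ n * a ^ n \<in> soc"
      using soc_add[OF 1 soc_add[OF 3 4]] unfolding 5 .
    then show ?thesis by (rule vn_regular_if_diff[OF soc_vn_regular[OF semiprime]])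
  qed
  define s where "s = a ^ k - b * a ^ Suc k"
  obtain S where S: "finite_length S" "s \<in> S" using soc_finite_length[OF b] by (auto simp: s_def)
  obtain l :: "'a set \<Rightarrow> nat" where
    l: "\<And>K L. right_ideal K \<Longrightarrow> right_ideal L \<Longrightarrow> K \<subset> L \<Longrightarrow> L \<subseteq> S \<Longrightarrow> l K < l L"
    using S unfolding finite_length_def by metis
  \<comment> \<open>\<open>D n\<close> is R(a) \<inter> \<open>a ^ n * A\<close>. If
    \<open>a ^ Suc k * v = 0\<close>, then \<open>a ^ k * v = s * v\<close>, so \<open>D n\<close>
    lies in \<open>S\<close> for \<open>n \<ge> k\<close>, and the decreasing chain stops where its
    length is least.\<close>
  define D where "D n = {a ^ n * z | z. a ^ Suc n * z = 0}" for n
  have D_ideal: "right_ideal (D n)" for n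
  proof (rule right_idealI)
    show "0 \<in> D n" by (auto simp: D_def intro: exI[of _ 0])
    show "x + y \<in> D n" if "x \<in> D n" "y \<in> D n" for x y
    proof -
      obtain z w where "x = a ^ n * z" "y = a ^ n * w" "a ^ Suc n * z = 0" "a ^ Suc n * w = 0"
        using \<open>x \<in> D n\<close> \<open>y \<in> D n\<close> unfolding D_def by blast
      then show ?thesis
        unfolding D_def by (intro CollectI exI[of _ "z + w"]) (simp add: distrib_left)
    qed
    show "x * t \<in> D n" if "x \<in> D n" for x t
      using that unfolding D_def by clarify (metis mult.assoc mult_zero_left)
  qed
  have D_sub: "D n \<subseteq> S" if n: "n \<ge> k" for n
  proof
    fix y assume "y \<in> D n"
    then obtain z where z: "y = a ^ n * z" "a ^ Suc n * z = 0" by (auto simp: D_def)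
    define v where "v = a ^ (n - k) * z"
    have "y = a ^ k * v" "a ^ Suc k * v = 0"
      using z n by (simp_all add: v_def flip: mult.assoc power_add) (simp add: mult.assoc flip: power_add)
    then have "y = s * v" by (simp add: s_def left_diff_distrib mult.assoc del: power_Suc)
    then show "y \<in> S" using S right_idealD(4)[of S s v] by (simp add: finite_length_def)
  qed
  have D_anti: "D m \<subseteq> D n" if "n \<le> m" for m n
  proof
    fix y assume "y \<in> D m"
    then obtain z where z: "y = a ^ m * z" "a ^ Suc m * z = 0" by (auto simp: D_def)
    then have "y = a ^ n * (a ^ (m - n) * z)" "a ^ Suc n * (a ^ (m - n) * z) = 0"
      using that by (simp_all add: mult.assoc[symmetric] flip: power_add power_Suc)
    then show "y \<in> D n" by (auto simp: D_def)
  qed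
  obtain d where d: "d \<ge> k" and min: "\<And>m. m \<ge> k \<Longrightarrow> l (D d) \<le> l (D m)"
    using ex_has_least_nat[of "\<lambda>n. n \<ge> k" k "\<lambda>n. l (D n)"] by auto
  have "D m = D d" if "m \<ge> d" for m
  proof (rule ccontr)
    assume "D m \<noteq> D d"
    then have "l (D m) < l (D d)" using D_anti[OF that] D_sub[OF d] by (intro l D_ideal) auto
    with min[of m] d that show False by simp
  qed
  then have "a ^ d * z \<in> D m" if "m \<ge> d" "a ^ Suc d * z = 0" for m z
    using that unfolding D_def by blast
  then have "uniform_descent a d"
    unfolding uniform_descent_def using regular order_trans[OF d] unfolding D_def by blast
  then show ?thesis ..
qed

section \<open>The opposite algebra\<close>

text \<open>The algebra is a whole type, so the opposite algebra must be a type of its own: the same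
  normed space and scalars with reversed multiplication.\<close>

typedef 'a opposite = "UNIV :: 'a set"
  morphisms of_opp to_opp ..

setup_lifting type_definition_opposite

instantiation opposite :: (complex_banach_algebra) real_normed_algebra_1
begin

lift_definition zero_opposite :: "'a opposite" is 0 .
lift_definition one_opposite :: "'a opposite" is 1 .
lift_definition plus_opposite :: "'a opposite \<Rightarrow> 'a opposite \<Rightarrow> 'a opposite" is "(+)" .
lift_definition minus_opposite :: "'a opposite \<Rightarrow> 'a opposite \<Rightarrow> 'a opposite" is "(-)" .
lift_definition uminus_opposite :: "'a opposite \<Rightarrow> 'a opposite" is uminus .
lift_definition times_opposite :: "'a opposite \<Rightarrow> 'a opposite \<Rightarrow> 'a opposite" is "\<lambda>x y. y * x" .
lift_definition scaleR_opposite :: "real \<Rightarrow> 'a opposite \<Rightarrow> 'a opposite" is "scaleR" .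
lift_definition norm_opposite :: "'a opposite \<Rightarrow> real" is norm .
lift_definition sgn_opposite :: "'a opposite \<Rightarrow> 'a opposite" is sgn .
lift_definition dist_opposite :: "'a opposite \<Rightarrow> 'a opposite \<Rightarrow> real" is dist .

definition uniformity_opposite :: "('a opposite \<times> 'a opposite) filter" where
  "uniformity_opposite = (INF e\<in>{0<..}. principal {(x, y). dist x y < e})"

definition open_opposite :: "'a opposite set \<Rightarrow> bool" where
  "open_opposite U \<longleftrightarrow> (\<forall>x\<in>U. eventually (\<lambda>(x', y). x' = x \<longrightarrow> y \<in> U) uniformity)"

instance
proof
  fix x y z :: "'a opposite" and r s :: real and U :: "'a opposite set"
  show "x + y + z = x + (y + z)" by transfer (rule add.assoc)
  show "x + y = y + x" by transfer (rule add.commute)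
  show "0 + x = x" by transfer simp
  show "- x + x = 0" by transfer simp
  show "x - y = x + - y" by transfer simp
  show "r *\<^sub>R (x + y) = r *\<^sub>R x + r *\<^sub>R y" by transfer (rule scaleR_add_right)
  show "(r + s) *\<^sub>R x = r *\<^sub>R x + s *\<^sub>R x" by transfer (rule scaleR_add_left)
  show "r *\<^sub>R s *\<^sub>R x = (r * s) *\<^sub>R x" by transfer simp
  show "1 *\<^sub>R x = x" by transfer simp
  show "x * y * z = x * (y * z)" by transfer (simp add: mult.assoc)
  show "(x + y) * z = x * z + y * z" by transfer (rule distrib_left)
  show "x * (y + z) = x * y + x * z" by transfer (rule distrib_right)
  show "r *\<^sub>R x * y = r *\<^sub>R (x * y)" by transfer simp
  show "x * r *\<^sub>R y = r *\<^sub>R (x * y)" by transfer simp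
  show "1 * x = x" by transfer simp
  show "x * 1 = x" by transfer simp
  show "0 \<noteq> (1 :: 'a opposite)" by transfer simp
  show "dist x y = norm (x - y)" by transfer (rule dist_norm)
  show "sgn x = inverse (norm x) *\<^sub>R x" by transfer (rule sgn_div_norm)
  show "(uniformity :: ('a opposite \<times> 'a opposite) filter) = (INF e\<in>{0<..}. principal {(x, y). dist x y < e})"
    by (rule uniformity_opposite_def)
  show "open U = (\<forall>x\<in>U. eventually (\<lambda>(x', y). x' = x \<longrightarrow> y \<in> U) uniformity)"
    by (rule open_opposite_def)
  show "(norm x = 0) = (x = 0)" by transfer simp
  show "norm (x + y) \<le> norm x + norm y" by transfer (rule norm_triangle_ineq)
  show "norm (r *\<^sub>R x) = \<bar>r\<bar> * norm x" by transfer simp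
  show "norm (x * y) \<le> norm x * norm y" by transfer (metis norm_mult_ineq mult.commute)
  show "norm (1 :: 'a opposite) = 1" by transfer simp
qed

end

instance opposite :: (complex_banach_algebra) banach
proof
  fix X :: "nat \<Rightarrow> 'a opposite"
  assume "Cauchy X"
  then have "Cauchy (\<lambda>n. of_opp (X n))"
    by (simp add: Cauchy_def dist_opposite.rep_eq)
  then obtain L where "(\<lambda>n. of_opp (X n)) \<longlonglongrightarrow> L"
    using Cauchy_convergent convergent_def by blast
  then have "X \<longlonglongrightarrow> to_opp L"
    by (simp add: lim_sequentially dist_opposite.rep_eq to_opp_inverse)
  then show "convergent X" by (rule convergentI)
qed

instantiation opposite :: (complex_banach_algebra) complex_banach_algebra
begin

lift_definition scaleC_opposite :: "complex \<Rightarrow> 'a opposite \<Rightarrow> 'a opposite" is scaleC .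

instance
proof
  fix x y :: "'a opposite" and c d :: complex and r :: real
  show "c *\<^sub>C (x + y) = c *\<^sub>C x + c *\<^sub>C y" by transfer (rule scaleC_add_right)
  show "(c + d) *\<^sub>C x = c *\<^sub>C x + d *\<^sub>C x" by transfer (rule scaleC_add_left)
  show "c *\<^sub>C d *\<^sub>C x = (c * d) *\<^sub>C x" by transfer (rule scaleC_scaleC)
  show "complex_of_real r *\<^sub>C x = r *\<^sub>R x" by transfer (rule scaleC_of_real)
  show "c *\<^sub>C x * y = c *\<^sub>C (x * y)" by transfer (rule mult_scaleC_right)
  show "x * c *\<^sub>C y = c *\<^sub>C (x * y)" by transfer (rule mult_scaleC_left)
  show "norm (c *\<^sub>C x) = cmod c * norm x" by transfer (rule norm_scaleC)
qed

end

lemma of_opp_power: "of_opp (x ^ n) = of_opp x ^ n"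
  by (induction n) (simp_all add: one_opposite.rep_eq times_opposite.rep_eq power_commutes)

lemma of_opp_of_complex: "of_opp (of_complex c) = of_complex c"
  by (simp add: of_complex_def scaleC_opposite.rep_eq one_opposite.rep_eq)

lemmas of_opp_simps = of_opp_inject[symmetric] to_opp_inverse of_opp_power of_opp_of_complex
  zero_opposite.rep_eq one_opposite.rep_eq minus_opposite.rep_eq times_opposite.rep_eq

lemma ex_opposite: "(\<exists>y. P (of_opp y)) \<longleftrightarrow> (\<exists>y. P y)"
  by (metis UNIV_I to_opp_inverse)

lemma left_spectrum_opp: "left_spectrum (to_opp x) = right_spectrum x"
  by (simp add: left_spectrum_def right_spectrum_def of_opp_simps
      ex_opposite[of "\<lambda>y. (x - of_complex _) * y = 1"])

lemma bounded_linear_opp: "bounded_linear of_opp" "bounded_linear to_opp"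
  by (intro bounded_linear_intro[of _ 1];
      simp add: of_opp_simps plus_opposite.rep_eq scaleR_opposite.rep_eq norm_opposite.rep_eq)+

lemma vector_holomorphic_opp:
  "vector_holomorphic_on f U \<Longrightarrow> vector_holomorphic_on (\<lambda>z. to_opp (f z)) U"
  "vector_holomorphic_on g U \<Longrightarrow> vector_holomorphic_on (\<lambda>z. of_opp (g z)) U"
proof -
  have scaleC: "to_opp (c *\<^sub>C x) = c *\<^sub>C to_opp x" for c and x :: 'a
    by (simp add: of_opp_simps scaleC_opposite.rep_eq)
  show "vector_holomorphic_on (\<lambda>z. to_opp (f z)) U" if "vector_holomorphic_on f U"
    unfolding vector_holomorphic_on_def
  proof
    fix z assume "z \<in> U"
    then obtain d where "(f has_derivative (\<lambda>h. h *\<^sub>C d)) (at z within U)"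
      using \<open>vector_holomorphic_on f U\<close> unfolding vector_holomorphic_on_def by blast
    from bounded_linear.has_derivative[OF bounded_linear_opp(2) this]
    show "\<exists>d. ((\<lambda>z. to_opp (f z)) has_derivative (\<lambda>h. h *\<^sub>C d)) (at z within U)"
      unfolding scaleC by blast
  qed
  show "vector_holomorphic_on (\<lambda>z. of_opp (g z)) U" if "vector_holomorphic_on g U"
    unfolding vector_holomorphic_on_def
  proof
    fix z assume "z \<in> U"
    then obtain d where "(g has_derivative (\<lambda>h. h *\<^sub>C d)) (at z within U)"
      using \<open>vector_holomorphic_on g U\<close> unfolding vector_holomorphic_on_def by blast
    from bounded_linear.has_derivative[OF bounded_linear_opp(1) this]
    show "\<exists>d. ((\<lambda>z. of_opp (g z)) has_derivative (\<lambda>h. h *\<^sub>C d)) (at z within U)"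
      unfolding scaleC_opposite.rep_eq by blast
  qed
qed

lemma left_SVEP_at_opp: "left_SVEP_at (to_opp x) \<zeta> \<longleftrightarrow> right_SVEP_at x \<zeta>"
proof
  assume L: "left_SVEP_at (to_opp x) \<zeta>"
  show "right_SVEP_at x \<zeta>" unfolding right_SVEP_at_def
  proof (intro allI impI, elim conjE)
    fix U f
    assume U: "open U" "connected U" "\<zeta> \<in> U" and hol: "vector_holomorphic_on f U"
      and f: "\<forall>\<mu>\<in>U. f \<mu> * (of_complex \<mu> - x) = 0"
    have "(of_complex \<mu> - to_opp x) * to_opp (f \<mu>) = 0" if "\<mu> \<in> U" for \<mu>
      using f[rule_format, OF that] by (simp add: of_opp_simps)
    then have "\<forall>\<mu>\<in>U. to_opp (f \<mu>) = 0"
      using L U vector_holomorphic_opp(1)[OF hol] unfolding left_SVEP_at_def by blast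
    then show "\<forall>\<mu>\<in>U. f \<mu> = 0" by (simp add: of_opp_simps)
  qed
next
  assume R: "right_SVEP_at x \<zeta>"
  show "left_SVEP_at (to_opp x) \<zeta>" unfolding left_SVEP_at_def
  proof (intro allI impI, elim conjE)
    fix U f
    assume U: "open U" "connected U" "\<zeta> \<in> U" and hol: "vector_holomorphic_on f U"
      and f: "\<forall>\<mu>\<in>U. (of_complex \<mu> - to_opp x) * f \<mu> = 0"
    have "of_opp (f \<mu>) * (of_complex \<mu> - x) = 0" if "\<mu> \<in> U" for \<mu>
      using arg_cong[OF f[rule_format, OF that], of of_opp] by (simp add: of_opp_simps)
    then have "\<forall>\<mu>\<in>U. of_opp (f \<mu>) = 0"
      using R U vector_holomorphic_opp(2)[OF hol] unfolding right_SVEP_at_def by blast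
    then show "\<forall>\<mu>\<in>U. f \<mu> = 0" by (simp add: of_opp_simps)
  qed
qed

text \<open>Uniform descent is transferred instead of the B-Fredholm property because the socle of
  the opposite algebra is built from the minimal left ideals of the original one.\<close>

lemma uniform_descent_opp:
  assumes "uniform_descent a d"
  shows "uniform_descent (to_opp a) d"
  unfolding uniform_descent_def
proof (intro conjI allI impI)
  fix n assume "d \<le> n"
  then obtain c where "a ^ n * c * a ^ n = a ^ n"
    using assms by (auto simp: uniform_descent_def vn_regular_def)
  then have "to_opp a ^ n * to_opp c * to_opp a ^ n = to_opp a ^ n"
    by (simp add: of_opp_simps mult.assoc)
  then show "vn_regular (to_opp a ^ n)" unfolding vn_regular_def by blast
next
  fix m z assume "d \<le> m" "to_opp a ^ Suc d * z = 0"
  then have "of_opp z * a ^ Suc d = 0"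
    by (simp add: of_opp_simps power_commutes del: power_Suc)
  from uniform_descent_left[OF assms \<open>d \<le> m\<close> this] obtain w where "of_opp z * a ^ d = w * a ^ m" ..
  then have "to_opp a ^ d * z = to_opp a ^ m * to_opp w" by (simp add: of_opp_simps)
  then show "\<exists>w. to_opp a ^ d * z = to_opp a ^ m * w" ..
qed

text \<open>Regularity of the powers makes \<open>a\<^sup>n A\<close> the right annihilator of the left annihilator of
  \<open>a\<^sup>n\<close>, so that the descent becomes the ascent in the opposite algebra.\<close>

lemma p_l_opp_finite:
  assumes ud: "uniform_descent a d"
  shows "p_l (to_opp a) < \<infinity> \<longleftrightarrow> q_l a < \<infinity>"
proof
  assume "q_l a < \<infinity>"
  then obtain n where n: "range (\<lambda>b. a ^ n * b) = range (\<lambda>b. a ^ (n + 1) * b)"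
    unfolding q_l_finite by blast
  have "a ^ n * 1 \<in> range (\<lambda>b. a ^ n * b)" by (rule rangeI)
  then obtain w where w: "a ^ n = a ^ (n + 1) * w" unfolding n by auto
  have "z * a ^ n = 0 \<longleftrightarrow> z * a ^ (n + 1) = 0" for z
  proof
    show "z * a ^ n = 0 \<Longrightarrow> z * a ^ (n + 1) = 0"
      by (simp add: power_commutes[symmetric] flip: mult.assoc)
    show "z * a ^ (n + 1) = 0 \<Longrightarrow> z * a ^ n = 0"
      by (subst w) (simp flip: mult.assoc)
  qed
  then have "right_annihilator (to_opp a ^ n) = right_annihilator (to_opp a ^ (n + 1))"
    unfolding right_annihilator_def by (simp add: of_opp_simps del: power_Suc)
  then show "p_l (to_opp a) < \<infinity>" unfolding p_l_finite by blast
next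
  assume "p_l (to_opp a) < \<infinity>"
  then obtain n where "right_annihilator (to_opp a ^ n) = right_annihilator (to_opp a ^ (n + 1))"
    unfolding p_l_finite by blast
  then have "\<And>z. to_opp a ^ Suc n * z = 0 \<Longrightarrow> to_opp a ^ n * z = 0"
    unfolding right_annihilator_def by auto
  then have "to_opp a ^ Suc (n + d) * z = 0 \<Longrightarrow> to_opp a ^ (n + d) * z = 0" for z
    by (rule power_annihilator_mono) auto
  from this[of "to_opp _"]
  have ann: "z * a ^ Suc (n + d) = 0 \<Longrightarrow> z * a ^ (n + d) = 0" for z
    by (simp add: of_opp_simps del: power_Suc)
  let ?N = "n + d"
  obtain c where c: "a ^ Suc ?N * c * a ^ Suc ?N = a ^ Suc ?N"
    using ud[unfolded uniform_descent_def, THEN conjunct1, rule_format, of "Suc ?N"]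
    unfolding vn_regular_def by auto
  \<comment> \<open>The left factor annihilates \<open>a ^ Suc ?N\<close>, hence already
    \<open>a ^ ?N\<close>; so \<open>a ^ ?N\<close> lies in the range of
    \<open>a ^ Suc ?N\<close>.\<close>
  have "(1 - a ^ Suc ?N * c) * a ^ Suc ?N = 0"
    using c by (simp only: left_diff_distrib mult_1_left diff_self)
  from ann[OF this] have "a ^ ?N = a ^ Suc ?N * (c * a ^ ?N)"
    by (simp only: left_diff_distrib mult_1_left mult.assoc eq_iff_diff_eq_0[symmetric])
  then have "a ^ ?N * b \<in> range (\<lambda>b. a ^ (?N + 1) * b)" for b
    by (metis Suc_eq_plus1 mult.assoc rangeI)
  moreover have "a ^ (?N + 1) * b \<in> range (\<lambda>b. a ^ ?N * b)" for b
    by (metis Suc_eq_plus1 mult.assoc power_Suc2 rangeI)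
  ultimately have "range (\<lambda>b. a ^ ?N * b) = range (\<lambda>b. a ^ (?N + 1) * b)" by blast
  then show "q_l a < \<infinity>" unfolding q_l_finite by blast
qed

lemma uniform_descent_dichotomy_right:
  assumes ud: "uniform_descent (x - of_complex \<alpha>) d"
  shows "q_l (x - of_complex \<alpha>) < \<infinity> \<Longrightarrow> \<exists>r>0. \<forall>\<mu>\<in>ball \<alpha> r - {\<alpha>}. \<mu> \<notin> right_spectrum x"
    and "q_l (x - of_complex \<alpha>) = \<infinity> \<Longrightarrow> \<exists>r>0. \<forall>\<mu>\<in>ball \<alpha> r. \<not> right_SVEP_at x \<mu>"
proof -
  have opp: "to_opp (x - of_complex \<alpha>) = to_opp x - of_complex \<alpha>"
    by (simp add: of_opp_simps)
  note ud' = uniform_descent_opp[OF ud, unfolded opp]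
  note q_l = p_l_opp_finite[OF ud, unfolded opp]
  show "q_l (x - of_complex \<alpha>) < \<infinity> \<Longrightarrow> \<exists>r>0. \<forall>\<mu>\<in>ball \<alpha> r - {\<alpha>}. \<mu> \<notin> right_spectrum x"
    using uniform_descent_dichotomy(1)[OF ud'] q_l by (simp add: left_spectrum_opp)
  show "q_l (x - of_complex \<alpha>) = \<infinity> \<Longrightarrow> \<exists>r>0. \<forall>\<mu>\<in>ball \<alpha> r. \<not> right_SVEP_at x \<mu>"
    using uniform_descent_dichotomy(2)[OF ud'] q_l by (simp add: left_SVEP_at_opp)
qed

lemma right_SVEP_at_if_punctured:
  assumes "r > 0" and "\<And>\<mu>. \<mu> \<in> ball \<alpha> r - {\<alpha>} \<Longrightarrow> \<mu> \<notin> right_spectrum x"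
  shows "right_SVEP_at x \<alpha>"
  using left_SVEP_at_if_punctured[OF assms(1), of \<alpha> "to_opp x"] assms(2)
  by (simp add: left_SVEP_at_opp left_spectrum_opp)

section \<open>B-Fredholm elements\<close>

lemma type_ring_minus: "a \<ominus>\<^bsub>type_ring\<^esub> b = (a - b :: 'a::ring_1)"
proof -
  interpret ring "type_ring :: 'a ring" by (rule ring_type_ring)
  have "\<ominus>\<^bsub>type_ring\<^esub> b = - b"
    by (rule minus_equality) (simp_all add: type_ring_def)
  then show ?thesis by (simp add: a_minus_def) (simp add: type_ring_def)
qed

lemma ideal_soc: "ideal (soc :: 'a::complex_banach_algebra set) type_ring"
proof (rule idealI[OF ring_type_ring])
  interpret ring "type_ring :: 'a ring" by (rule ring_type_ring)
  show "subgroup (soc :: 'a set) (add_monoid type_ring)"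
  proof (rule add.subgroupI)
    show "(soc :: 'a set) \<noteq> {}" using soc_zero by blast
    fix a :: 'a assume a: "a \<in> soc"
    have "\<ominus>\<^bsub>type_ring\<^esub> a = - a"
      by (rule minus_equality) (simp_all add: type_ring_def)
    then show "\<ominus>\<^bsub>type_ring\<^esub> a \<in> soc"
      using soc_mult_left[OF a, of "- 1"] by simp
  qed (auto simp: type_ring_def intro: soc_add)
qed (auto simp: type_ring_def intro: soc_mult_left soc_mult_right)

lemma soc_coset:
  fixes a b :: "'a::complex_banach_algebra"
  defines "Q \<equiv> type_ring Quot (soc :: 'a set)" and "\<pi> \<equiv> (+>\<^bsub>type_ring\<^esub>) (soc :: 'a set)"
  shows "\<pi> a = \<pi> b \<longleftrightarrow> a - b \<in> soc" and "\<pi> a \<otimes>\<^bsub>Q\<^esub> \<pi> b = \<pi> (a * b)"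
    and "\<pi> a [^]\<^bsub>Q\<^esub> (n::nat) = \<pi> (a ^ n)" and "carrier Q = range \<pi>"
proof -
  interpret I: ideal "soc :: 'a set" type_ring by (rule ideal_soc)
  have carrier: "c \<in> carrier type_ring" for c :: 'a by (simp add: type_ring_def)
  show "\<pi> a = \<pi> b \<longleftrightarrow> a - b \<in> soc"
    unfolding \<pi>_def using I.quotient_eq_iff_same_a_r_cos[OF ideal_soc carrier carrier, of a b]
    by (simp add: type_ring_minus)
  have mult: "\<pi> a \<otimes>\<^bsub>Q\<^esub> \<pi> b = \<pi> (a * b)" for a b
    using ring_hom_mult[OF I.rcos_ring_hom carrier carrier, of a b]
    by (simp add: Q_def \<pi>_def) (simp add: type_ring_def)
  then show "\<pi> a \<otimes>\<^bsub>Q\<^esub> \<pi> b = \<pi> (a * b)" .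
  have "\<one>\<^bsub>Q\<^esub> = \<pi> 1"
    using ring_hom_one[OF I.rcos_ring_hom] by (simp add: Q_def \<pi>_def) (simp add: type_ring_def)
  then show "\<pi> a [^]\<^bsub>Q\<^esub> (n::nat) = \<pi> (a ^ n)"
    by (induction n) (simp_all add: mult power_commutes)
  show "carrier Q = range \<pi>"
    by (auto simp: Q_def \<pi>_def FactRing_def A_RCOSETS_def' type_ring_def)
qed

lemma B_Fredholm_iff:
  fixes a :: "'a::complex_banach_algebra"
  shows "B_Fredholm a \<longleftrightarrow> (\<exists>b k. b * a * b - b \<in> soc \<and> a * b - b * a \<in> soc \<and> a ^ k * b * a - a ^ k \<in> soc)"
  unfolding B_Fredholm_def drazin_invertible_def by (auto simp: soc_coset)

lemma B_Fredholm_if_invertible: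
  assumes "y * a = 1" "a * y = 1"
  shows "B_Fredholm a"
  unfolding B_Fredholm_iff using assms soc_zero by (intro exI[of _ y] exI[of _ 0]) simp

text \<open>As \<open>b\<close> commutes with \<open>a\<close> modulo the socle,
  \<open>a ^ k * b * a\<close> can be rewritten as \<open>b * a ^ Suc k\<close> and as
  \<open>a ^ Suc k * b\<close>, so \<open>b\<close> serves on both sides.\<close>

lemma B_Fredholm_uniform_descent:
  fixes a :: "'a::complex_banach_algebra"
  assumes semiprime: "semiprime_algebra TYPE('a)" and "B_Fredholm a"
  shows "\<exists>d. uniform_descent a d"
proof -
  obtain b k where comm: "a * b - b * a \<in> soc" and bk: "a ^ k * b * a - a ^ k \<in> soc"
    using assms(2) unfolding B_Fredholm_iff by blast
  have comm_pow: "a ^ n * b - b * a ^ n \<in> soc" for n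
  proof (induction n)
    case (Suc n)
    have "a ^ Suc n * b - b * a ^ Suc n = a * (a ^ n * b - b * a ^ n) + (a * b - b * a) * a ^ n"
      by (simp add: algebra_simps)
    then show ?case using soc_add[OF soc_mult_left[OF Suc] soc_mult_right[OF comm]] by metis
  qed (simp add: soc_zero)
  have bk': "a ^ k - a ^ k * b * a \<in> soc"
    using soc_mult_left[OF bk, of "- 1"] by simp
  have "a ^ k - b * a ^ Suc k = (a ^ k - a ^ k * b * a) + (a ^ k * b - b * a ^ k) * a"
    by (simp add: algebra_simps power_commutes)
  then have 1: "a ^ k - b * a ^ Suc k \<in> soc"
    using soc_add[OF bk' soc_mult_right[OF comm_pow]] by metis
  have "a ^ k - a ^ Suc k * b = (a ^ k - a ^ k * b * a) + (- (a ^ k)) * (a * b - b * a)"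
    by (simp add: algebra_simps power_commutes) (simp add: power_commutes flip: mult.assoc)
  then have 2: "a ^ k - a ^ Suc k * b \<in> soc"
    using soc_add[OF bk' soc_mult_left[OF comm]] by metis
  show ?thesis by (rule uniform_descent_mod_soc[OF semiprime 1 2])
qed

section \<open>Ascent and descent: invertible elements and equality in the finite case\<close>

lemma p_l_finite_if_left_invertible:
  assumes "\<mu> \<notin> left_spectrum x"
  shows "p_l (x - of_complex \<mu>) < \<infinity>"
proof -
  obtain y where y: "y * (x - of_complex \<mu>) = 1" using assms by (auto simp: left_spectrum_def)
  have "z = 0" if "(x - of_complex \<mu>) * z = 0" for z
    using that y by (metis mult.assoc mult_1 mult_zero_right)
  then show ?thesis unfolding p_l_finite by (intro exI[of _ 0]) (auto simp: right_annihilator_def)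
qed

lemma q_l_finite_if_right_invertible:
  assumes "\<mu> \<notin> right_spectrum x"
  shows "q_l (x - of_complex \<mu>) < \<infinity>"
proof -
  obtain y where y: "(x - of_complex \<mu>) * y = 1" using assms by (auto simp: right_spectrum_def)
  have "z = (x - of_complex \<mu>) * (y * z)" for z
    using y by (simp flip: mult.assoc)
  then have "range (\<lambda>a. (x - of_complex \<mu>) * a) = UNIV" by blast
  then show ?thesis unfolding q_l_finite by (intro exI[of _ 0]) simp
qed

text \<open>\<open>P\<close> and \<open>Q\<close> are the sets of exponents at which the two chains
  stop. If both are nonempty they coincide, and so do their infima.\<close>

lemma p_l_eq_q_l:
  assumes "p_l a < \<infinity>" "q_l a < \<infinity>"
  shows "p_l a = q_l a"
proof -
  define P where "P = {n. right_annihilator (a ^ n) = right_annihilator (a ^ (n + 1))}"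
  define Q where "Q = {n. range (\<lambda>b. a ^ n * b) = range (\<lambda>b. a ^ (n + 1) * b)}"
  have P: "n \<in> P \<longleftrightarrow> (\<forall>z. a ^ Suc n * z = 0 \<longrightarrow> a ^ n * z = 0)" for n
    by (auto simp: P_def right_annihilator_def mult.assoc)
  have Q: "n \<in> Q \<longleftrightarrow> (\<exists>w. a ^ n = a ^ Suc n * w)" for n
  proof
    assume "n \<in> Q"
    moreover have "a ^ n * 1 \<in> range (\<lambda>b. a ^ n * b)" by (rule rangeI)
    ultimately show "\<exists>w. a ^ n = a ^ Suc n * w" unfolding Q_def by auto
  next
    assume "\<exists>w. a ^ n = a ^ Suc n * w"
    then obtain w where w: "a ^ n = a ^ Suc n * w" ..
    have "a ^ n * b = a ^ Suc n * (w * b)" "a ^ Suc n * b = a ^ n * (a * b)" for b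
      using w by (simp_all only: power_Suc2 flip: mult.assoc)
    then have "a ^ n * b \<in> range (\<lambda>b. a ^ (n + 1) * b)" "a ^ (n + 1) * b \<in> range (\<lambda>b. a ^ n * b)" for b
      by (metis Suc_eq_plus1 rangeI)+
    then show "n \<in> Q" unfolding Q_def by blast
  qed
  have PQ: "n \<in> P" if "p \<in> P" "n \<in> Q" for p n
    unfolding P
  proof (intro allI impI)
    fix z assume z: "a ^ Suc n * z = 0"
    obtain w where w: "a ^ n = a ^ Suc n * w" using \<open>n \<in> Q\<close> Q by blast
    \<comment> \<open>For \<open>j = p\<close>, \<open>a ^ Suc n * z = 0\<close> becomes
      \<open>a ^ Suc p * (a ^ n * v * z) = 0\<close>; the ascent condition at \<open>p\<close>
      removes one factor, leaving \<open>a ^ n * z = 0\<close>.\<close>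
    have "\<exists>v. a ^ n = a ^ (n + j) * v" for j
    proof (induction j)
      case (Suc j)
      then obtain v where "a ^ n = a ^ (n + j) * v" ..
      also have "a ^ (n + j) = a ^ j * (a ^ Suc n * w)"
        unfolding w[symmetric] by (simp add: add.commute flip: power_add)
      also have "\<dots> = a ^ (n + Suc j) * w"
        by (simp only: add.commute[of j] add_Suc_shift flip: mult.assoc power_add)
      finally show ?case by (metis mult.assoc)
    qed (auto intro: exI[of _ 1])
    then obtain v where v: "a ^ n = a ^ (n + p) * v" by blast
    have "a ^ Suc p * (a ^ n * v * z) = a * (a ^ (n + p) * v) * z"
      by (simp add: add.commute[of n] power_add mult.assoc)
    also have "\<dots> = 0" using z by (simp flip: v)
    finally have "a ^ p * (a ^ n * v * z) = 0" using \<open>p \<in> P\<close> P by blast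
    then have "a ^ (n + p) * v * z = 0" by (simp add: add.commute[of n] power_add mult.assoc)
    then show "a ^ n * z = 0" using v by simp
  qed
  have QP: "n \<in> Q" if "n \<in> P" "q \<in> Q" for n q
  proof -
    obtain w where w: "a ^ q = a ^ Suc q * w" using \<open>q \<in> Q\<close> Q by blast
    have "a ^ (n + q) * (1 - a * w) = a ^ n * (a ^ q - a ^ Suc q * w)"
      by (simp only: power_add power_Suc2 right_diff_distrib mult.assoc mult_1_right)
    then have "a ^ (n + q) * (1 - a * w) = 0" by (simp only: w[symmetric] diff_self mult_zero_right)
    then have "a ^ n * (1 - a * w) = 0"
      by (rule power_annihilator_add[rotated]) (use \<open>n \<in> P\<close> P in blast)
    then have "a ^ n = a ^ Suc n * w"
      by (simp add: right_diff_distrib power_commutes flip: mult.assoc)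
    then show ?thesis using Q by blast
  qed
  have "P \<noteq> {}" "Q \<noteq> {}"
    using assms unfolding p_l_finite q_l_finite P_def Q_def by blast+
  then have "P = Q" using PQ QP by blast
  then show ?thesis unfolding p_l_def q_l_def P_def Q_def by simp
qed

section \<open>Limit points of spectra, and globalisation over a connected set\<close>

lemma not_islimpt_if_punctured:
  assumes "\<exists>r>0. \<forall>\<mu>\<in>ball \<alpha> r - {\<alpha>}. \<mu> \<notin> S"
  shows "\<not> \<alpha> islimpt S"
  using assms unfolding islimpt_approachable by (force simp: dist_commute)

lemma not_in_spectrum_iff:
  "\<mu> \<notin> spectrum x \<longleftrightarrow> \<mu> \<notin> left_spectrum x \<and> \<mu> \<notin> right_spectrum x"
proof
  assume "\<mu> \<notin> left_spectrum x \<and> \<mu> \<notin> right_spectrum x"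
  then obtain y z where y: "y * (x - of_complex \<mu>) = 1" and z: "(x - of_complex \<mu>) * z = 1"
    by (auto simp: left_spectrum_def right_spectrum_def)
  then have "y = z" by (metis mult.assoc mult_1_left mult_1_right)
  with y z show "\<mu> \<notin> spectrum x" by (auto simp: spectrum_def)
qed (auto simp: spectrum_def left_spectrum_def right_spectrum_def)

lemma connected_constant_if_locally:
  fixes P :: "'a::metric_space \<Rightarrow> bool"
  assumes "connected S" and loc: "\<And>a. a \<in> S \<Longrightarrow> \<exists>r>0. \<forall>b\<in>ball a r \<inter> S. P b = P a"
  shows "(\<forall>a\<in>S. P a) \<or> (\<forall>a\<in>S. \<not> P a)"
proof -
  have "P a = P b" if "a \<in> S" "b \<in> S" for a b
  proof (rule connected_local_const[OF assms(1) that], intro ballI)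
    fix a assume "a \<in> S"
    from loc[OF this] show "\<forall>\<^sub>F b in at a within S. P a = P b"
      unfolding eventually_at by (auto simp: dist_commute)
  qed
  then show ?thesis by blast
qed

theorem theorem4p3:
  fixes x :: "'a::complex_banach_algebra" and \<Omega> :: "complex set"
  assumes "semiprime_algebra TYPE('a)"
    and "(soc :: 'a set) \<noteq> {0}"
    and "\<Omega> \<in> components (BF_resolvent x)"
  shows
    "let C1 = (\<forall>\<zeta>\<in>\<Omega>. left_SVEP_at x \<zeta>) \<and> (\<forall>\<zeta>\<in>\<Omega>. right_SVEP_at x \<zeta>);
         C2 = (\<forall>\<zeta>\<in>\<Omega>. left_SVEP_at x \<zeta>) \<and> (\<forall>\<zeta>\<in>\<Omega>. \<not> right_SVEP_at x \<zeta>);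
         C3 = (\<forall>\<zeta>\<in>\<Omega>. right_SVEP_at x \<zeta>) \<and> (\<forall>\<zeta>\<in>\<Omega>. \<not> left_SVEP_at x \<zeta>);
         C4 = (\<forall>\<zeta>\<in>\<Omega>. \<not> left_SVEP_at x \<zeta>) \<and> (\<forall>\<zeta>\<in>\<Omega>. \<not> right_SVEP_at x \<zeta>)
     in
       (C1 \<or> C2 \<or> C3 \<or> C4) \<and>
       \<not> (C1 \<and> C2) \<and> \<not> (C1 \<and> C3) \<and> \<not> (C1 \<and> C4) \<and>
       \<not> (C2 \<and> C3) \<and> \<not> (C2 \<and> C4) \<and> \<not> (C3 \<and> C4) \<and>
       (C1 \<longrightarrow>
          (\<forall>\<zeta>\<in>\<Omega>. p_l (x - of_complex \<zeta>) = q_l (x - of_complex \<zeta>) \<and>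
                   q_l (x - of_complex \<zeta>) < \<infinity>) \<and>
          (\<forall>\<zeta>\<in>\<Omega>. \<not> \<zeta> islimpt spectrum x)) \<and>
       (C1 \<longleftrightarrow> \<Omega> \<inter> resolvent_set x \<noteq> {}) \<and>
       (C2 \<longrightarrow>
          (\<forall>\<zeta>\<in>\<Omega>. p_l (x - of_complex \<zeta>) < \<infinity> \<and> q_l (x - of_complex \<zeta>) = \<infinity>) \<and>
          (\<forall>\<zeta>\<in>\<Omega>. \<not> \<zeta> islimpt left_spectrum x) \<and>
          \<Omega> \<subseteq> right_spectrum x) \<and>
       (C3 \<longrightarrow>
          (\<forall>\<zeta>\<in>\<Omega>. p_l (x - of_complex \<zeta>) = \<infinity> \<and> q_l (x - of_complex \<zeta>) < \<infinity>) \<and>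
          (\<forall>\<zeta>\<in>\<Omega>. \<not> \<zeta> islimpt right_spectrum x) \<and>
          \<Omega> \<subseteq> left_spectrum x) \<and>
       (C4 \<longrightarrow>
          (\<forall>\<zeta>\<in>\<Omega>. p_l (x - of_complex \<zeta>) = \<infinity> \<and> q_l (x - of_complex \<zeta>) = \<infinity>) \<and>
          \<Omega> \<subseteq> left_spectrum x \<inter> right_spectrum x)"
proof -
  let ?p = "\<lambda>\<zeta>. p_l (x - of_complex \<zeta>)" and ?q = "\<lambda>\<zeta>. q_l (x - of_complex \<zeta>)"
  have \<Omega>: "\<Omega> \<noteq> {}" "connected \<Omega>" "\<Omega> \<subseteq> BF_resolvent x"
    using assms(3) in_components_nonempty in_components_connected in_components_subset by blast+
  have ud: "\<exists>d. uniform_descent (x - of_complex \<alpha>) d" if "\<alpha> \<in> \<Omega>" for \<alpha>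
    using B_Fredholm_uniform_descent[OF assms(1)] that \<Omega>(3)
    by (auto simp: BF_resolvent_def BF_spectrum_def)
  have left: "?p \<alpha> < \<infinity> \<Longrightarrow> \<exists>r>0. \<forall>\<mu>\<in>ball \<alpha> r - {\<alpha>}. \<mu> \<notin> left_spectrum x"
    "?p \<alpha> = \<infinity> \<Longrightarrow> \<exists>r>0. \<forall>\<mu>\<in>ball \<alpha> r. \<not> left_SVEP_at x \<mu>" if "\<alpha> \<in> \<Omega>" for \<alpha>
    using ud[OF that] uniform_descent_dichotomy by blast+
  have right: "?q \<alpha> < \<infinity> \<Longrightarrow> \<exists>r>0. \<forall>\<mu>\<in>ball \<alpha> r - {\<alpha>}. \<mu> \<notin> right_spectrum x"
    "?q \<alpha> = \<infinity> \<Longrightarrow> \<exists>r>0. \<forall>\<mu>\<in>ball \<alpha> r. \<not> right_SVEP_at x \<mu>" if "\<alpha> \<in> \<Omega>" for \<alpha>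
    using ud[OF that] uniform_descent_dichotomy_right by blast+
  have p: "left_SVEP_at x \<alpha> \<longleftrightarrow> ?p \<alpha> < \<infinity>" if "\<alpha> \<in> \<Omega>" for \<alpha>
  proof
    assume "?p \<alpha> < \<infinity>"
    then show "left_SVEP_at x \<alpha>"
      using left(1)[OF that] left_SVEP_at_if_punctured by blast
  next
    assume "left_SVEP_at x \<alpha>"
    then show "?p \<alpha> < \<infinity>"
      using left(2)[OF that] centre_in_ball enat_ord_simps(4) by blast
  qed
  have q: "right_SVEP_at x \<alpha> \<longleftrightarrow> ?q \<alpha> < \<infinity>" if "\<alpha> \<in> \<Omega>" for \<alpha>
  proof
    assume "?q \<alpha> < \<infinity>"
    then show "right_SVEP_at x \<alpha>"
      using right(1)[OF that] right_SVEP_at_if_punctured by blast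
  next
    assume "right_SVEP_at x \<alpha>"
    then show "?q \<alpha> < \<infinity>"
      using right(2)[OF that] centre_in_ball enat_ord_simps(4) by blast
  qed
  \<comment> \<open>Both alternatives are open: finite ascent at \<open>\<alpha>\<close> gives left
    invertibility, hence finite ascent, at nearby points, and infinite ascent destroys the SVEP on a
    whole disc.\<close>
  have p_cases: "(\<forall>\<alpha>\<in>\<Omega>. left_SVEP_at x \<alpha>) \<or> (\<forall>\<alpha>\<in>\<Omega>. \<not> left_SVEP_at x \<alpha>)"
  proof (rule connected_constant_if_locally[OF \<Omega>(2)])
    fix \<alpha> assume \<alpha>: "\<alpha> \<in> \<Omega>"
    show "\<exists>r>0. \<forall>\<mu>\<in>ball \<alpha> r \<inter> \<Omega>. left_SVEP_at x \<mu> = left_SVEP_at x \<alpha>"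
    proof (cases "?p \<alpha> < \<infinity>")
      case True
      then obtain r where "r > 0" "\<forall>\<mu>\<in>ball \<alpha> r - {\<alpha>}. \<mu> \<notin> left_spectrum x"
        using left(1)[OF \<alpha>] by blast
      then show ?thesis using p p_l_finite_if_left_invertible True \<alpha> by (metis DiffI IntE singletonD)
    next
      case False
      then show ?thesis using left(2)[OF \<alpha>] by (metis IntE centre_in_ball enat_ord_simps(4))
    qed
  qed
  have q_cases: "(\<forall>\<alpha>\<in>\<Omega>. right_SVEP_at x \<alpha>) \<or> (\<forall>\<alpha>\<in>\<Omega>. \<not> right_SVEP_at x \<alpha>)"
  proof (rule connected_constant_if_locally[OF \<Omega>(2)])
    fix \<alpha> assume \<alpha>: "\<alpha> \<in> \<Omega>"
    show "\<exists>r>0. \<forall>\<mu>\<in>ball \<alpha> r \<inter> \<Omega>. right_SVEP_at x \<mu> = right_SVEP_at x \<alpha>"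
    proof (cases "?q \<alpha> < \<infinity>")
      case True
      then obtain r where "r > 0" "\<forall>\<mu>\<in>ball \<alpha> r - {\<alpha>}. \<mu> \<notin> right_spectrum x"
        using right(1)[OF \<alpha>] by blast
      then show ?thesis using q q_l_finite_if_right_invertible True \<alpha> by (metis DiffI IntE singletonD)
    next
      case False
      then show ?thesis using right(2)[OF \<alpha>] by (metis IntE centre_in_ball enat_ord_simps(4))
    qed
  qed
  have left_spec: "\<alpha> \<in> left_spectrum x" if "\<alpha> \<in> \<Omega>" "\<not> left_SVEP_at x \<alpha>" for \<alpha>
    using that p p_l_finite_if_left_invertible by blast
  have right_spec: "\<alpha> \<in> right_spectrum x" if "\<alpha> \<in> \<Omega>" "\<not> right_SVEP_at x \<alpha>" for \<alpha>
    using that q q_l_finite_if_right_invertible by blast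
  have left_lim: "\<not> \<alpha> islimpt left_spectrum x" if "\<alpha> \<in> \<Omega>" "left_SVEP_at x \<alpha>" for \<alpha>
    using that p left(1) not_islimpt_if_punctured by blast
  have right_lim: "\<not> \<alpha> islimpt right_spectrum x" if "\<alpha> \<in> \<Omega>" "right_SVEP_at x \<alpha>" for \<alpha>
    using that q right(1) not_islimpt_if_punctured by blast
  have punctured: "\<exists>r>0. \<forall>\<mu>\<in>ball \<alpha> r - {\<alpha>}. \<mu> \<notin> spectrum x"
    if \<alpha>: "\<alpha> \<in> \<Omega>" "left_SVEP_at x \<alpha>" "right_SVEP_at x \<alpha>" for \<alpha>
  proof -
    obtain r s where rs: "r > 0" "\<forall>\<mu>\<in>ball \<alpha> r - {\<alpha>}. \<mu> \<notin> left_spectrum x"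
      "s > 0" "\<forall>\<mu>\<in>ball \<alpha> s - {\<alpha>}. \<mu> \<notin> right_spectrum x"
      using \<alpha> p q left(1) right(1) by metis
    then show ?thesis by (intro exI[of _ "min r s"]) (auto simp: not_in_spectrum_iff)
  qed
  have resolvent: "\<Omega> \<inter> resolvent_set x \<noteq> {}"
    if \<alpha>: "\<alpha> \<in> \<Omega>" "left_SVEP_at x \<alpha>" "right_SVEP_at x \<alpha>" for \<alpha>
  proof -
    obtain r where r: "r > 0" "\<forall>\<mu>\<in>ball \<alpha> r - {\<alpha>}. \<mu> \<notin> spectrum x"
      using punctured[OF \<alpha>] by blast
    \<comment> \<open>The point \<open>\<alpha>\<close> may itself be in the spectrum, so a
      neighbouring point is used. The ball is connected, meets the component \<open>\<Omega>\<close>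
      and lies in the B-Fredholm resolvent, so maximality places it in
      \<open>\<Omega>\<close>.\<close>
    then have "ball \<alpha> r - {\<alpha>} \<subseteq> BF_resolvent x"
      by (auto simp: BF_resolvent_def BF_spectrum_def spectrum_def intro: B_Fredholm_if_invertible)
    then have "ball \<alpha> r \<subseteq> BF_resolvent x" using \<alpha>(1) \<Omega>(3) by blast
    then have "ball \<alpha> r \<subseteq> \<Omega>"
      using components_maximal[OF assms(3) connected_ball] \<alpha>(1) r(1) centre_in_ball by blast
    moreover have "\<alpha> + of_real (r / 2) \<in> ball \<alpha> r - {\<alpha>}"
      using r(1) by (simp add: dist_norm)
    ultimately show ?thesis using r(2) unfolding resolvent_set_def by blast
  qed
  have SVEP: "left_SVEP_at x \<alpha> \<and> right_SVEP_at x \<alpha>" if "\<alpha> \<in> \<Omega> \<inter> resolvent_set x" for \<alpha>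
    using that left_spec right_spec not_in_spectrum_iff[of \<alpha> x] by (auto simp: resolvent_set_def)
  have lim: "\<not> \<alpha> islimpt spectrum x" if "\<alpha> \<in> \<Omega>" "left_SVEP_at x \<alpha>" "right_SVEP_at x \<alpha>" for \<alpha>
    using punctured[OF that] by (rule not_islimpt_if_punctured)
  have eq: "?p \<alpha> = ?q \<alpha>" if "\<alpha> \<in> \<Omega>" "left_SVEP_at x \<alpha>" "right_SVEP_at x \<alpha>" for \<alpha>
    using that p q p_l_eq_q_l by blast
  have infinite: "?p \<alpha> = \<infinity> \<longleftrightarrow> \<not> left_SVEP_at x \<alpha>" "?q \<alpha> = \<infinity> \<longleftrightarrow> \<not> right_SVEP_at x \<alpha>" if "\<alpha> \<in> \<Omega>" for \<alpha>
    using p[OF that] q[OF that] by simp_all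
  let ?L = "\<forall>\<zeta>\<in>\<Omega>. left_SVEP_at x \<zeta>" and ?R = "\<forall>\<zeta>\<in>\<Omega>. right_SVEP_at x \<zeta>"
  \<comment> \<open>As \<open>\<Omega>\<close> is nonempty, failure everywhere is the negation of
    validity everywhere. The four cases become the four truth assignments to \<open>?L\<close> and
    \<open>?R\<close>, so exhaustion and exclusion are propositional.\<close>
  have not_L: "(\<forall>\<zeta>\<in>\<Omega>. \<not> left_SVEP_at x \<zeta>) \<longleftrightarrow> \<not> ?L"
    using p_cases \<Omega>(1) by blast
  have not_R: "(\<forall>\<zeta>\<in>\<Omega>. \<not> right_SVEP_at x \<zeta>) \<longleftrightarrow> \<not> ?R"
    using q_cases \<Omega>(1) by blast
  have "?L \<and> ?R \<longrightarrow> (\<forall>\<zeta>\<in>\<Omega>. ?p \<zeta> = ?q \<zeta> \<and> ?q \<zeta> < \<infinity>) \<and> (\<forall>\<zeta>\<in>\<Omega>. \<not> \<zeta> islimpt spectrum x)"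
    using eq lim q by blast
  moreover have "?L \<and> ?R \<longleftrightarrow> \<Omega> \<inter> resolvent_set x \<noteq> {}"
    using resolvent SVEP not_L not_R \<Omega>(1) by blast
  moreover have "?L \<and> \<not> ?R \<longrightarrow> (\<forall>\<zeta>\<in>\<Omega>. ?p \<zeta> < \<infinity> \<and> ?q \<zeta> = \<infinity>) \<and>
      (\<forall>\<zeta>\<in>\<Omega>. \<not> \<zeta> islimpt left_spectrum x) \<and> \<Omega> \<subseteq> right_spectrum x"
    unfolding not_R[symmetric] using p infinite left_lim right_spec by blast
  moreover have "?R \<and> \<not> ?L \<longrightarrow> (\<forall>\<zeta>\<in>\<Omega>. ?p \<zeta> = \<infinity> \<and> ?q \<zeta> < \<infinity>) \<and>
      (\<forall>\<zeta>\<in>\<Omega>. \<not> \<zeta> islimpt right_spectrum x) \<and> \<Omega> \<subseteq> left_spectrum x"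
    unfolding not_L[symmetric] using q infinite right_lim left_spec by blast
  moreover have "\<not> ?L \<and> \<not> ?R \<longrightarrow> (\<forall>\<zeta>\<in>\<Omega>. ?p \<zeta> = \<infinity> \<and> ?q \<zeta> = \<infinity>) \<and>
      \<Omega> \<subseteq> left_spectrum x \<inter> right_spectrum x"
    unfolding not_L[symmetric] not_R[symmetric] using infinite left_spec right_spec by blast
  ultimately show ?thesis
    unfolding Let_def not_L not_R by argo
qed

end
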